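(* Let $\mathscr{C}$ be a cell class with respect to $\ell_1,\dots,\ell_n$. Suppose $\delta_{\mathscr{C}}$ has a local maximum at $\mathbf{a}/q$, where $q>1$ is a power of $p$, $\mathbf{a}\in[q]^n$, and $\mathbf{a}/q$ is reduced, in the sense that some coordinate $a_i/q$ is reduced (i.e. some $a_i$ is not divisible by $p$). Then $$\delta_{\mathscr{C}}\left(\frac{\mathbf{a}}{q}\right)\le\frac{n-2}{q}.$$
   Context: Let $\Bbbk$ be a field of characteristic $p>0$, $n\ge 1$, and let $\ell_1,\dots,\ell_n\in\Bbbk[x,y]$ be pairwise relatively prime (nonzero) linear forms; put $\ell=\prod_i\ell_i$ and $\ell^{\mathbf{a}}=\prod_i\ell_i^{a_i}$ for $\mathbf{a}\in\mathbb{Z}_{\ge0}^n$. The letter $q$ denotes a power of $p$, $[q]=\{0,1,\dots,q\}$, and $\mathscr{I}=[0,1]\cap\mathbb{Z}[1/p]$. For nonzero homogeneous $F,G,H\in\Bbbk[x,y]$, a homogeneous syzygy $(\alpha,\beta,\gamma)$ (with $\alpha F+\beta G+\gamma H=0$) has degree equal to the common degree of the nonzero terms among $\alpha F,\beta G,\gamma H$; $m(F,G,H)$ is the least degree of a nontrivial homogeneous syzygy, and $\delta(F,G,H)=\deg F+\deg G+\deg H-2m(F,G,H)$. A cell (with respect to $\ell_1,\dots,\ell_n$) is a triple $C=(F,G,H)$ of nonzero homogeneous polynomials in $\Bbbk[x,y]$ such that $F$, $G$ and $H\ell$ have no common factor. The function $\delta_C:\mathscr{I}^n\to\mathbb{Q}$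 is defined by $\delta_C(\mathbf{a}/q)=\frac1q\,\delta(F^q,G^q,H^q\ell^{\mathbf{a}})$ for all $q$ and $\mathbf{a}\in[q]^n$ (this is well defined because $\delta(F^p,G^p,H^p)=p\,\delta(F,G,H)$). Two cells $C_1,C_2$ are equivalent if $\delta_{C_1}=\delta_{C_2}$; a cell class $\mathscr{C}$ is an equivalence class of cells, and $\delta_{\mathscr{C}}=\delta_C$ for any $C\in\mathscr{C}$. "Local maximum" is meant in the usual sense on $\mathscr{I}^n\subseteq\mathbb{R}^n$ with the subspace topology. *)

theory Defs
  imports "HOL-Analysis.Analysis"
begin

text \<open>
  The ring \<open>k[x,y]\<close> is represented as \<open>'a poly poly\<close>: the coefficient of \<open>x^i y^j\<close>
  in \<open>P\<close> is \<open>coeff (coeff P j) i\<close>. As usual, the zero polynomial is homogeneous of every degree.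
\<close>

definition homog_deg :: "nat \<Rightarrow> 'a::zero poly poly \<Rightarrow> bool" where
  "homog_deg d P \<longleftrightarrow> (\<forall>i j. coeff (coeff P j) i \<noteq> 0 \<longrightarrow> i + j = d)"

definition homog :: "'a::zero poly poly \<Rightarrow> bool" where
  "homog P \<longleftrightarrow> (\<exists>d. homog_deg d P)"

text \<open>The total degree; it is only applied to nonzero homogeneous polynomials.\<close>

definition total_deg :: "'a::zero poly poly \<Rightarrow> nat" where
  "total_deg P = (LEAST d. \<forall>i j. coeff (coeff P j) i \<noteq> 0 \<longrightarrow> i + j \<le> d)"

definition linear_form :: "'a::zero poly poly \<Rightarrow> bool" where
  "linear_form L \<longleftrightarrow> L \<noteq> 0 \<and> homog_deg 1 L"

text \<open>
  Since zero is homogeneous of every degree, the three conditions on \<open>\<alpha> * F\<close>, \<open>\<beta> * G\<close> and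
  \<open>\<gamma> * H\<close> say that the nonzero ones among them have common degree \<open>d\<close>.
\<close>

definition homog_syzygy ::
  "nat \<Rightarrow> 'a::field poly poly \<Rightarrow> 'a poly poly \<Rightarrow> 'a poly poly \<Rightarrow>
     'a poly poly \<times> 'a poly poly \<times> 'a poly poly \<Rightarrow> bool" where
  "homog_syzygy d F G H = (\<lambda>(\<alpha>, \<beta>, \<gamma>).
     homog \<alpha> \<and> homog \<beta> \<and> homog \<gamma> \<and>
     \<alpha> * F + \<beta> * G + \<gamma> * H = 0 \<and>
     homog_deg d (\<alpha> * F) \<and> homog_deg d (\<beta> * G) \<and> homog_deg d (\<gamma> * H))"

definition min_syzygy_deg ::
  "'a::field poly poly \<Rightarrow> 'a poly poly \<Rightarrow> 'a poly poly \<Rightarrow> nat" where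
  "min_syzygy_deg F G H = (LEAST d. \<exists>S. S \<noteq> (0, 0, 0) \<and> homog_syzygy d F G H S)"

definition syzygy_gap ::
  "'a::field poly poly \<Rightarrow> 'a poly poly \<Rightarrow> 'a poly poly \<Rightarrow> int" where
  "syzygy_gap F G H =
     int (total_deg F) + int (total_deg G) + int (total_deg H) - 2 * int (min_syzygy_deg F G H)"

type_synonym 'a triple = "'a poly poly \<times> 'a poly poly \<times> 'a poly poly"

definition is_cell :: "('n::finite \<Rightarrow> 'a::field poly poly) \<Rightarrow> 'a triple \<Rightarrow> bool" where
  "is_cell l = (\<lambda>(F, G, H).
     F \<noteq> 0 \<and> G \<noteq> 0 \<and> H \<noteq> 0 \<and> homog F \<and> homog G \<and> homog H \<and>
     (\<forall>D. D dvd F \<longrightarrow> D dvd G \<longrightarrow> D dvd H * (\<Prod>i\<in>UNIV. l i) \<longrightarrow> is_unit D))"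

definition unit_interval_p :: "nat \<Rightarrow> real set" where
  "unit_interval_p p = {0..1} \<inter> {of_int k / of_nat (p ^ e) | k e. True}"

definition cube_p :: "nat \<Rightarrow> (real ^ 'n) set" where
  "cube_p p = {t. \<forall>i. t $ i \<in> unit_interval_p p}"

definition scaled_point :: "nat ^ 'n \<Rightarrow> nat \<Rightarrow> real ^ 'n" where
  "scaled_point a q = (\<chi> i. real (a $ i) / real q)"

text \<open>
  The value of \<open>\<delta>\<^sub>C\<close> at a point \<open>t\<close> of \<open>cube_p p\<close> is the common value of the defining expression
  over all representations \<open>t = a / q\<close> with \<open>q\<close> a power of \<open>p\<close>. It is unspecified at other points.
\<close>

definition cell_delta ::
  "nat \<Rightarrow> ('n::finite \<Rightarrow> 'a::field poly poly) \<Rightarrow> 'a triple \<Rightarrow> real ^ 'n \<Rightarrow> rat" where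
  "cell_delta p l = (\<lambda>(F, G, H) t. THE v. \<forall>q a.
     (\<exists>e. q = p ^ e) \<longrightarrow> (\<forall>i. a $ i \<le> q) \<longrightarrow> t = scaled_point a q \<longrightarrow>
       v = of_int (syzygy_gap (F ^ q) (G ^ q) (H ^ q * (\<Prod>i\<in>UNIV. l i ^ (a $ i)))) / of_nat q)"

definition cell_equiv ::
  "nat \<Rightarrow> ('n::finite \<Rightarrow> 'a::field poly poly) \<Rightarrow> ('a triple \<times> 'a triple) set" where
  "cell_equiv p l = {(C1, C2). is_cell l C1 \<and> is_cell l C2 \<and>
     (\<forall>t\<in>cube_p p. cell_delta p l C1 t = cell_delta p l C2 t)}"

definition cell_classes ::
  "nat \<Rightarrow> ('n::finite \<Rightarrow> 'a::field poly poly) \<Rightarrow> 'a triple set set" where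
  "cell_classes p l = Collect (is_cell l) // cell_equiv p l"

definition class_delta ::
  "nat \<Rightarrow> ('n::finite \<Rightarrow> 'a::field poly poly) \<Rightarrow> 'a triple set \<Rightarrow> real ^ 'n \<Rightarrow> rat" where
  "class_delta p l \<C> t = (THE v. \<forall>C\<in>\<C>. cell_delta p l C t = v)"

definition local_max_on ::
  "'b::topological_space set \<Rightarrow> ('b \<Rightarrow> 'c::order) \<Rightarrow> 'b \<Rightarrow> bool" where
  "local_max_on S f t \<longleftrightarrow>
     (\<exists>U. openin (top_of_set S) U \<and> t \<in> U \<and> (\<forall>s\<in>U. f s \<le> f t))"

end

theory Submission
  imports Defs "Berlekamp_Zassenhaus.Unique_Factorization_Poly"
begin

text \<open>
  Fix a cell \<open>(F, G, H)\<close> in the class and let \<open>S = (\<alpha>, \<beta>, \<gamma>)\<close> be a syzygy of minimal degree \<open>m\<close> of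
  the triple \<open>T\<^sub>a = (F^q, G^q, H^q l^a)\<close>. Its syzygy gap is \<open>gap q a\<close>, so that the value at
  \<open>a / q\<close> is \<open>gap q a / q\<close> and the claim reads \<open>gap q a \<le> n - 2\<close>.

  \<^emph>\<open>Primitive short syzygies are minimal.\<close> The cross product of two syzygies of a triple without
  common factor is a polynomial multiple of the triple itself. If the degrees of the two syzygies
  add up to less than the degree sum of the triple, this multiple must be zero, and the syzygies
  are proportional. Hence a syzygy whose entries have no common factor and whose degree is at most
  half of the degree sum has minimal degree (\<open>primitive_syzygy_minimal\<close>). Conversely, counting
  coefficients shows that some syzygy has at most half of the degree sum as its degree. It follows
  that gaps are nonnegative and that taking \<open>p\<close>-th powers multiplies them by \<open>p\<close>, so that the
  function on the cube is well defined.

  \<^emph>\<open>What a peak says about the minimal syzygy.\<close> At a finer scale \<open>q Q\<close> the minimal syzygy at the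
  same point is the power \<open>(\<alpha>^Q, \<beta>^Q, \<gamma>^Q)\<close>. If \<open>l\<^sub>i\<close> divided \<open>\<gamma>\<close>, moving one factor \<open>l\<^sub>i\<close> from
  \<open>\<gamma>^Q\<close> into the triple would give a larger gap at the upper neighbour; if \<open>l\<^sub>i\<close> divided \<open>\<alpha>\<close> and
  \<open>\<beta>\<close>, cancelling \<open>l\<^sub>i\<close> would give a larger gap at the lower neighbour. So at a peak neither happens
  in any coordinate in the interior (\<open>peak_up\<close>, \<open>peak_down\<close>).

  \<^emph>\<open>Differentiation.\<close> Let \<open>D\<close> be a directional derivative, and let \<open>K\<close> be the set of those \<open>j\<close> for
  which \<open>p\<close> does not divide \<open>a\<^sub>j\<close> and \<open>D l\<^sub>j \<noteq> 0\<close>. Since \<open>D\<close> kills \<open>p\<close>-th powers, applying it to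
  the relation \<open>\<alpha> F^q + \<beta> G^q + \<gamma> H^q l^a = 0\<close> produces a syzygy of degree \<open>m - 1\<close> of the triple
  \<open>T\<^sub>b\<close>, where \<open>b\<close> arises from \<open>a\<close> by lowering the coordinates in \<open>K\<close> by one. That triple also has
  the syzygy \<open>(\<alpha>, \<beta>, \<gamma> \<Prod>\<^sub>K l\<^sub>j)\<close> of degree \<open>m\<close>, which is primitive because \<open>a / q\<close> is a peak. If
  \<open>gap q a \<ge> |K|\<close>, it is also short, hence minimal, so the derived syzygy vanishes and
  \<open>D (\<gamma> l^a) = 0\<close>. For \<open>i\<close> in \<open>K\<close> this is absurd: \<open>l\<^sub>i\<close> occurs in \<open>\<gamma> l^a\<close> with multiplicity exactly
  \<open>a\<^sub>i\<close>, which is prime to \<open>p\<close>. Therefore \<open>gap q a < |K|\<close> as soon as \<open>K\<close> is nonempty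
  (\<open>gap_less_card\<close>).

  \<^emph>\<open>Choice of the direction.\<close> Let \<open>a\<^sub>i\<close> be prime to \<open>p\<close>. If \<open>n \<ge> 2\<close>, choose \<open>D\<close> such that it kills
  some \<open>l\<^sub>j\<close> with \<open>j \<noteq> i\<close> but not \<open>l\<^sub>i\<close>. Then \<open>i\<close> is in \<open>K\<close> and \<open>|K| \<le> n - 1\<close>, which gives the
  bound. If \<open>n = 1\<close>, take \<open>D\<close> with \<open>D l\<^sub>i \<noteq> 0\<close>; then \<open>gap q a < 1\<close>. This case does not occur,
  because the gap at a peak is positive: if it were zero, the neighbours at a finer scale would have
  gap zero as well, whereas one step changes the parity of the degree sum and hence of the gap
  (\<open>peak_bound\<close>).
\<close>

section \<open>Homogeneous polynomials in two variables\<close>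

(* The imported theory of factorial rings uses the name coprime and the infix symbol $ for notions
   of its own, and it rewrites prime elements to irreducible ones, which hides them from the
   divisibility rules for prime elements. *)
alias coprime = Rings.coprime
no_notation Matrix.vec_index (infixl \<open>$\<close> 100)
declare prime_elem_iff_irreducible [iff del]

text \<open>
  The substitution \<open>x \<mapsto> t\<close>, \<open>y \<mapsto> s t\<close>, where \<open>t\<close> is the outer and \<open>s\<close> the inner variable of the
  result. It makes the total degree the degree in the outer variable, so that homogeneous
  polynomials become monomials in \<open>t\<close>; being an injective ring homomorphism, it transports
  facts about the univariate degree to the total degree.
\<close>
definition regrade :: "'a::comm_ring_1 poly poly \<Rightarrow> 'a poly poly" where
  "regrade P = poly (map_poly (map_poly (\<lambda>a. [:a:])) P) (monom [:0, 1:] 1)"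

lemma regrade_0 [simp]: "regrade 0 = 0"
  by (simp add: regrade_def)

lemma regrade_pCons:
  "regrade (pCons c P) = map_poly (\<lambda>a. [:a:]) c + monom [:0, 1:] 1 * regrade P"
proof -
  have "map_poly (map_poly (\<lambda>a. [:a:])) (pCons c P) =
          pCons (map_poly (\<lambda>a. [:a:]) c) (map_poly (map_poly (\<lambda>a. [:a:])) P)"
    by (cases "c = 0 \<and> P = 0") (auto simp: map_poly_pCons)
  then show ?thesis by (simp add: regrade_def)
qed

lemma coeff_regrade:
  "coeff (coeff (regrade P) n) j = (if j \<le> n then coeff (coeff P j) (n - j) else 0)"
proof (induction P arbitrary: n j)
  case (pCons c P)
  have "coeff (coeff (monom [:0, 1:] 1 * regrade P) n) j =
          (if 1 \<le> j \<and> j \<le> n then coeff (coeff P (j - 1)) (n - j) else 0)"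
  proof (cases "n = 0 \<or> j = 0")
    case False
    then obtain n' j' where "n = Suc n'" "j = Suc j'" by (metis not0_implies_Suc)
    then show ?thesis by (simp add: coeff_monom_mult pCons.IH)
  qed (auto simp: coeff_monom_mult)
  then show ?case
    by (cases j) (simp_all add: regrade_pCons coeff_map_poly)
qed simp

lemma regrade_mult: "regrade (P * Q) = regrade P * regrade Q"
proof -
  interpret const: comm_ring_hom "\<lambda>a::'a. [:a:]"
    by unfold_locales simp_all
  interpret inner: map_poly_comm_ring_hom "\<lambda>a::'a. [:a:]" ..
  interpret outer: map_poly_comm_ring_hom "map_poly (\<lambda>a::'a. [:a:])" ..
  show ?thesis
    by (simp add: regrade_def outer.hom_mult)
qed

lemma regrade_add: "regrade (P + Q) = regrade P + regrade Q"
  by (intro poly_eqI) (simp add: coeff_regrade)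

lemma regrade_eq_0_iff [simp]: "regrade P = 0 \<longleftrightarrow> P = 0"
proof
  assume "regrade P = 0"
  show "P = 0"
  proof (intro poly_eqI)
    fix j i
    show "coeff (coeff P j) i = coeff (coeff 0 j) i"
      using coeff_regrade[of P "i + j" j] \<open>regrade P = 0\<close> by simp
  qed
qed simp

lemma homog_deg_iff_regrade:
  "homog_deg d P \<longleftrightarrow> (\<forall>n. n \<noteq> d \<longrightarrow> coeff (regrade P) n = 0)"
proof
  assume "homog_deg d P"
  have "coeff (coeff (regrade P) n) j = 0" if "n \<noteq> d" for n j
  proof (cases "j \<le> n \<and> coeff (coeff P j) (n - j) \<noteq> 0")
    case True
    then have "(n - j) + j = d"
      using \<open>homog_deg d P\<close> unfolding homog_deg_def by blast
    with True \<open>n \<noteq> d\<close> show ?thesis by simp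
  qed (auto simp: coeff_regrade)
  then show "\<forall>n. n \<noteq> d \<longrightarrow> coeff (regrade P) n = 0"
    by (simp add: poly_eq_iff)
next
  assume *: "\<forall>n. n \<noteq> d \<longrightarrow> coeff (regrade P) n = 0"
  show "homog_deg d P"
    unfolding homog_deg_def
  proof (intro allI impI)
    fix i j assume "coeff (coeff P j) i \<noteq> 0"
    moreover have "coeff (coeff (regrade P) (i + j)) j = coeff (coeff P j) i"
      by (simp add: coeff_regrade)
    ultimately have "coeff (regrade P) (i + j) \<noteq> 0"
      by (metis coeff_0)
    with * show "i + j = d" by blast
  qed
qed

lemma homog_deg_iff_monom:
  "homog_deg d P \<longleftrightarrow> (\<exists>f. regrade P = monom f d)"
proof
  assume "homog_deg d P"
  then have "regrade P = monom (coeff (regrade P) d) d"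
    by (auto simp: homog_deg_iff_regrade poly_eq_iff)
  then show "\<exists>f. regrade P = monom f d" ..
qed (auto simp: homog_deg_iff_regrade)

lemma homog_deg_0 [simp]: "homog_deg d 0"
  by (simp add: homog_deg_def)

lemma homog_deg_1: "homog_deg 0 1"
  by (auto simp: homog_deg_def coeff_1 split: if_splits)

lemma homog_deg_add: "homog_deg d P \<Longrightarrow> homog_deg d Q \<Longrightarrow> homog_deg d (P + Q)"
  for P Q :: "'a::comm_ring_1 poly poly"
  unfolding homog_deg_iff_regrade by (simp add: regrade_add)

lemma homog_deg_uminus: "homog_deg d (- P) \<longleftrightarrow> homog_deg d P"
  for P :: "'a::comm_ring_1 poly poly"
  by (simp add: homog_deg_def)

lemma homog_deg_diff: "homog_deg d P \<Longrightarrow> homog_deg d Q \<Longrightarrow> homog_deg d (P - Q)"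
  for P Q :: "'a::comm_ring_1 poly poly"
  using homog_deg_add[of d P "- Q"] by (simp add: homog_deg_uminus)

lemma homog_deg_mult: "homog_deg d P \<Longrightarrow> homog_deg e Q \<Longrightarrow> homog_deg (d + e) (P * Q)"
  for P Q :: "'a::comm_ring_1 poly poly"
  unfolding homog_deg_iff_monom regrade_mult by (metis mult_monom)

lemma homog_deg_power: "homog_deg d P \<Longrightarrow> homog_deg (n * d) (P ^ n)"
  for P :: "'a::comm_ring_1 poly poly"
  by (induction n) (auto simp: homog_deg_1 intro: homog_deg_mult)

lemma homog_deg_prod:
  fixes f :: "'i \<Rightarrow> 'a::comm_ring_1 poly poly"
  assumes "\<And>i. i \<in> A \<Longrightarrow> homog_deg (d i) (f i)"
  shows "homog_deg (\<Sum>i\<in>A. d i) (\<Prod>i\<in>A. f i)"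
  using assms by (induction A rule: infinite_finite_induct) (auto simp: homog_deg_1 intro: homog_deg_mult)

lemma nonzero_coeff_exists:
  assumes "P \<noteq> (0::'a::zero poly poly)"
  obtains i j where "coeff (coeff P j) i \<noteq> 0"
  using assms by (metis leading_coeff_0_iff)

lemma homog_deg_unique:
  assumes "homog_deg d P" "homog_deg e P" "P \<noteq> 0"
  shows "d = e"
  using assms by (metis homog_deg_def nonzero_coeff_exists)

lemma total_deg_eq:
  assumes "homog_deg d P" "P \<noteq> 0"
  shows "total_deg P = d"
proof -
  obtain i j where ij: "coeff (coeff P j) i \<noteq> 0"
    using \<open>P \<noteq> 0\<close> by (rule nonzero_coeff_exists)
  show ?thesis
    unfolding total_deg_def
  proof (rule Least_equality)
    show "\<forall>i j. coeff (coeff P j) i \<noteq> 0 \<longrightarrow> i + j \<le> d"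
      using assms by (auto simp: homog_deg_def)
    show "d \<le> y" if "\<forall>i j. coeff (coeff P j) i \<noteq> 0 \<longrightarrow> i + j \<le> y" for y
      using that ij assms by (auto simp: homog_deg_def)
  qed
qed

lemma homog_deg_total_deg: "homog P \<Longrightarrow> P \<noteq> 0 \<Longrightarrow> homog_deg (total_deg P) P"
  unfolding homog_def by (elim exE) (simp add: total_deg_eq)

text \<open>
  After regrading, a product that is a monomial in \<open>t\<close> has equal order at zero and degree. Both are
  additive and the order never exceeds the degree, so that they agree for each factor too.
\<close>
lemma homog_deg_mult_imp_factors:
  fixes P Q :: "'a::idom poly poly"
  assumes "homog_deg d (P * Q)" "P * Q \<noteq> 0"
  shows "\<exists>e e'. homog_deg e P \<and> homog_deg e' Q \<and> d = e + e'"
proof -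
  have single: "\<exists>f. U = monom f (degree U)" if "Polynomial.order 0 U = degree U" "U \<noteq> 0" for U :: "'a poly poly"
  proof -
    have "monom 1 (degree U) dvd U"
      using that by (metis monom_1_dvd_iff order_refl)
    then obtain V where V: "U = monom 1 (degree U) * V" by auto
    with \<open>U \<noteq> 0\<close> have "degree U = degree U + degree V"
      by (metis degree_mult_eq degree_monom_eq mult_eq_0_iff one_neq_zero)
    then obtain v where "V = [:v:]"
      by (metis add_cancel_right_right degree_eq_zeroE)
    with V show ?thesis by (metis mult_monom monom_0 add.right_neutral)
  qed
  obtain f where f: "regrade P * regrade Q = monom f d"
    using assms(1) by (auto simp: homog_deg_iff_monom regrade_mult)
  have nz: "regrade P \<noteq> 0" "regrade Q \<noteq> 0" "f \<noteq> 0"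
    using assms(2) f by auto
  have ord: "Polynomial.order 0 (regrade P) + Polynomial.order 0 (regrade Q) = d"
    using nz f by (metis order_mult order_0_monom monom_eq_0_iff)
  have deg: "degree (regrade P) + degree (regrade Q) = d"
    using nz f by (metis degree_mult_eq degree_monom_eq)
  have le: "Polynomial.order 0 U \<le> degree U" if "U \<noteq> 0" for U :: "'a poly poly"
    using that by (rule order_degree)
  have "Polynomial.order 0 (regrade P) = degree (regrade P)"
       "Polynomial.order 0 (regrade Q) = degree (regrade Q)"
    using ord deg le[OF nz(1)] le[OF nz(2)] by linarith+
  then have "homog_deg (degree (regrade P)) P" "homog_deg (degree (regrade Q)) Q"
    using single nz by (auto simp: homog_deg_iff_monom)
  then show ?thesis using deg by blast
qed

lemma homog_deg_cancel_left:
  fixes P Q :: "'a::idom poly poly"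
  assumes "homog_deg (d + e) (P * Q)" "homog_deg d P" "P \<noteq> 0"
  shows "homog_deg e Q"
proof (cases "Q = 0")
  case False
  with assms obtain d' e' where "homog_deg d' P" "homog_deg e' Q" "d + e = d' + e'"
    using homog_deg_mult_imp_factors[of "d + e" P Q] by auto
  with assms homog_deg_unique[of d P d'] show ?thesis by simp
qed simp

lemma homog_deg_0_imp_unit:
  fixes P :: "'a::field poly poly"
  assumes "homog_deg 0 P" "P \<noteq> 0"
  shows "is_unit P"
proof -
  have *: "coeff (coeff P j) i = 0" if "i + j \<noteq> 0" for i j
    using assms(1) that unfolding homog_deg_def by blast
  have "P = [:[:coeff (coeff P 0) 0:]:]"
    by (intro poly_eqI) (auto simp: coeff_pCons * split: nat.splits)
  then obtain c where "P = [:[:c:]:]" by blast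
  with \<open>P \<noteq> 0\<close> show ?thesis by (auto simp: is_unit_const_poly_iff dvd_field_iff)
qed

lemma unit_imp_homog_deg_0:
  fixes P :: "'a::field poly poly"
  assumes "is_unit P"
  shows "homog_deg 0 P"
proof -
  obtain Q where "1 = P * Q" using assms by (elim dvdE)
  then show ?thesis
    using homog_deg_mult_imp_factors[of 0 P Q] homog_deg_1 by auto
qed

lemma prime_dvd_exists:
  fixes P :: "'a::ufd"
  assumes "P \<noteq> 0" "\<not> P dvd 1"
  shows "\<exists>\<pi>. prime_elem \<pi> \<and> \<pi> dvd P"
  using assms
  by (metis mset_factors_exist mset_factorsE mset_factors_imp_dvd prime_elem_iff_irreducible multiset_nonemptyE)

lemma prime_elem_linear_form:
  fixes L :: "'a::field poly poly"
  assumes "linear_form L"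
  shows "prime_elem L"
proof -
  have L: "L \<noteq> 0" "homog_deg 1 L" using assms by (auto simp: linear_form_def)
  have "\<not> is_unit L"
    using unit_imp_homog_deg_0[of L] homog_deg_unique[OF L(2) _ L(1), of 0] by auto
  moreover have "is_unit P \<or> is_unit Q" if LPQ: "L = P * Q" for P Q
  proof -
    obtain e e' where e: "homog_deg e P" "homog_deg e' Q" "1 = e + e'"
      using homog_deg_mult_imp_factors[of 1 P Q] L unfolding LPQ[symmetric] by blast
    have "P \<noteq> 0" "Q \<noteq> 0" using L LPQ by auto
    with e show ?thesis
      using homog_deg_0_imp_unit[of P] homog_deg_0_imp_unit[of Q]
      by (cases "e = 0"; cases "e' = 0") auto
  qed
  ultimately have "irreducible L" using L(1) by (intro irreducibleI)
  then show ?thesis by (simp only: prime_elem_iff_irreducible)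
qed

section \<open>Triples without common factor\<close>

definition no_common_factor :: "'a::idom \<Rightarrow> 'a \<Rightarrow> 'a \<Rightarrow> bool" where
  "no_common_factor A B C \<longleftrightarrow> (\<forall>D. D dvd A \<longrightarrow> D dvd B \<longrightarrow> D dvd C \<longrightarrow> D dvd 1)"

lemma no_common_factor_rotate: "no_common_factor A B C \<Longrightarrow> no_common_factor B C A"
  unfolding no_common_factor_def by blast

lemma no_common_factor_nonzero:
  assumes "no_common_factor A B C"
  shows "A \<noteq> 0 \<or> B \<noteq> 0 \<or> C \<noteq> 0"
proof (rule ccontr)
  assume "\<not> ?thesis"
  then have "(0::'a) dvd 1"
    using assms unfolding no_common_factor_def by (metis dvd_refl)
  then show False by simp
qed

lemma no_common_factor_prime:
  "no_common_factor A B C \<Longrightarrow> prime_elem \<pi> \<Longrightarrow> \<pi> dvd A \<Longrightarrow> \<pi> dvd B \<Longrightarrow> \<pi> dvd C \<Longrightarrow> False"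
  unfolding no_common_factor_def prime_elem_def by blast

lemma no_common_factorI:
  fixes A B C :: "'a::ufd"
  assumes "A \<noteq> 0 \<or> B \<noteq> 0 \<or> C \<noteq> 0"
    and "\<And>\<pi>. prime_elem \<pi> \<Longrightarrow> \<pi> dvd A \<Longrightarrow> \<pi> dvd B \<Longrightarrow> \<pi> dvd C \<Longrightarrow> False"
  shows "no_common_factor A B C"
  unfolding no_common_factor_def
proof (intro allI impI)
  fix D assume D: "D dvd A" "D dvd B" "D dvd C"
  show "D dvd 1"
  proof (rule ccontr)
    assume "\<not> D dvd 1"
    have "D \<noteq> 0" using D assms(1) by auto
    from prime_dvd_exists[OF this \<open>\<not> D dvd 1\<close>] obtain \<pi> where \<pi>: "prime_elem \<pi>" "\<pi> dvd D"
      by (elim exE conjE)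
    show False
      by (rule assms(2)[OF \<pi>(1) dvd_trans[OF \<pi>(2) D(1)] dvd_trans[OF \<pi>(2) D(2)]
            dvd_trans[OF \<pi>(2) D(3)]])
  qed
qed

lemma no_common_factor_power:
  fixes A B C :: "'a::ufd"
  assumes "no_common_factor A B C"
  shows "no_common_factor (A ^ n) (B ^ n) (C ^ n)"
proof (rule no_common_factorI)
  show "A ^ n \<noteq> 0 \<or> B ^ n \<noteq> 0 \<or> C ^ n \<noteq> 0"
    using no_common_factor_nonzero[OF assms] by auto
qed (metis assms no_common_factor_prime prime_elem_dvd_power)

text \<open>
  This is where unique factorization enters: the three hypotheses say that \<open>F\<close> divides \<open>X\<close> times
  the greatest common divisor of \<open>A\<close>, \<open>B\<close>, \<open>C\<close>.
\<close>
lemma no_common_factor_dvd: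
  fixes A B C F X :: "'a::ufd"
  assumes "no_common_factor A B C" "F dvd X * A" "F dvd X * B" "F dvd X * C"
  shows "F dvd X"
proof -
  let ?g = "some_gcd.listgcd [A, B, C]"
  have "?g dvd A" "?g dvd B" "?g dvd C"
    by (rule some_gcd.listgcd; simp)+
  then have "?g dvd 1"
    using assms(1) unfolding no_common_factor_def by blast
  moreover have "F dvd ?g * X"
    using assms(2-4) by (intro some_gcd.listgcd_greatest_mult) (auto simp: mult.commute)
  ultimately show ?thesis
    by (metis dvd_trans mult_dvd_mono dvd_refl mult_1)
qed

lemma parallel_multiple_aux:
  fixes A B C A' B' C' :: "'a::ufd"
  assumes "no_common_factor A B C" "A \<noteq> 0"
    and "A * B' = B * A'" "A * C' = C * A'"
  shows "\<exists>c. A' = c * A \<and> B' = c * B \<and> C' = c * C"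
proof -
  have "A dvd A' * B" "A dvd A' * C"
    using assms(3,4) by (metis dvd_triv_left mult.commute)+
  then have "A dvd A'"
    using no_common_factor_dvd[OF assms(1), of A A'] by simp
  then obtain c where c: "A' = A * c" ..
  have "A * B' = A * (c * B)" "A * C' = A * (c * C)"
    using assms(3,4) c by (simp_all add: ac_simps)
  then have "B' = c * B" "C' = c * C" using \<open>A \<noteq> 0\<close> by simp_all
  then show ?thesis using c by (auto simp: mult.commute)
qed

text \<open>Vectors with vanishing cross product are proportional over the field of fractions; if one of them
  is primitive, the factor of proportionality has no denominator.\<close>
lemma parallel_multiple:
  fixes A B C A' B' C' :: "'a::ufd"
  assumes ncf: "no_common_factor A B C"
    and eq: "A * B' = B * A'" "A * C' = C * A'" "B * C' = C * B'"
  shows "\<exists>c. A' = c * A \<and> B' = c * B \<and> C' = c * C"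
proof -
  note rot = no_common_factor_rotate[OF ncf]
  consider "A \<noteq> 0" | "B \<noteq> 0" | "C \<noteq> 0"
    using no_common_factor_nonzero[OF ncf] by blast
  then show ?thesis
  proof cases
    case 1
    then show ?thesis using parallel_multiple_aux[OF ncf] eq by blast
  next
    case 2
    then show ?thesis using parallel_multiple_aux[OF rot, of C' B' A'] eq by metis
  next
    case 3
    then show ?thesis
      using parallel_multiple_aux[OF no_common_factor_rotate[OF rot], of A' C' B'] eq by metis
  qed
qed

lemma prime_elem_dvd_prodE:
  assumes "prime_elem \<pi>" "finite A" "\<pi> dvd (\<Prod>i\<in>A. f i)"
  obtains i where "i \<in> A" "\<pi> dvd f i"
proof -
  have "\<exists>i\<in>A. \<pi> dvd f i"
    using assms(2,3)
  proof (induction A rule: finite_induct)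
    case empty
    then show ?case using assms(1) by (simp add: prime_elem_def)
  next
    case (insert i A)
    then show ?case using prime_elem_dvd_mult_iff[OF assms(1)] by auto
  qed
  then show thesis using that by auto
qed

section \<open>Syzygies of minimal degree\<close>

definition coprime_forms :: "'a::field poly poly \<Rightarrow> 'a poly poly \<Rightarrow> 'a poly poly \<Rightarrow> bool" where
  "coprime_forms F G H \<longleftrightarrow>
     F \<noteq> 0 \<and> G \<noteq> 0 \<and> H \<noteq> 0 \<and> homog F \<and> homog G \<and> homog H \<and> no_common_factor F G H"

abbreviation deg_sum :: "'a::field poly poly \<Rightarrow> 'a poly poly \<Rightarrow> 'a poly poly \<Rightarrow> nat" where
  "deg_sum F G H \<equiv> total_deg F + total_deg G + total_deg H"

lemma homog_left_factor:
  fixes P Q :: "'a::idom poly poly"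
  assumes "homog_deg d (P * Q)" "Q \<noteq> 0"
  shows "homog P"
  using assms homog_deg_mult_imp_factors[of d P Q] unfolding homog_def
  by (cases "P = 0") auto

text \<open>The entries of a syzygy are factors of homogeneous polynomials, hence homogeneous themselves.\<close>
lemma homog_syzygy_iff:
  assumes "F \<noteq> 0" "G \<noteq> 0" "H \<noteq> 0"
  shows "homog_syzygy d F G H (\<alpha>, \<beta>, \<gamma>) \<longleftrightarrow> \<alpha> * F + \<beta> * G + \<gamma> * H = 0 \<and>
           homog_deg d (\<alpha> * F) \<and> homog_deg d (\<beta> * G) \<and> homog_deg d (\<gamma> * H)"
  using assms homog_left_factor unfolding homog_syzygy_def by blast

text \<open>
  Both syzygies are orthogonal to \<open>(F, G, H)\<close>, so their cross product \<open>(X, Y, Z)\<close> is parallel to it,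
  and even a multiple \<open>h (F, G, H)\<close> since \<open>F\<close>, \<open>G\<close>, \<open>H\<close> have no common factor. Comparing degrees,
  \<open>h \<noteq> 0\<close> is possible only if \<open>d + d'\<close> is at least the degree sum. Otherwise \<open>h = 0\<close> and the second
  syzygy is a multiple of the primitive one.
\<close>
lemma primitive_syzygy_minimal:
  assumes T: "coprime_forms F G H"
    and S: "homog_syzygy d F G H (\<alpha>, \<beta>, \<gamma>)" "no_common_factor \<alpha> \<beta> \<gamma>" "2 * d \<le> deg_sum F G H"
    and S': "homog_syzygy d' F G H (\<alpha>', \<beta>', \<gamma>')" "(\<alpha>', \<beta>', \<gamma>') \<noteq> (0, 0, 0)"
  shows "d \<le> d'"
proof (rule ccontr)
  assume "\<not> d \<le> d'"
  then have less: "d + d' < deg_sum F G H" using S(3) by linarith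
  have nz: "F \<noteq> 0" "G \<noteq> 0" "H \<noteq> 0" and hom: "homog F" "homog G" "homog H"
    and ncf: "no_common_factor F G H"
    using T by (auto simp: coprime_forms_def)
  note syz = S(1)[unfolded homog_syzygy_iff[OF nz]] S'(1)[unfolded homog_syzygy_iff[OF nz]]
  define X Y Z where XYZ: "X = \<beta> * \<gamma>' - \<gamma> * \<beta>'" "Y = \<gamma> * \<alpha>' - \<alpha> * \<gamma>'" "Z = \<alpha> * \<beta>' - \<beta> * \<alpha>'"
  have eqs: "\<alpha> * F + \<beta> * G + \<gamma> * H = 0" "\<alpha>' * F + \<beta>' * G + \<gamma>' * H = 0"
    using syz by auto
  have "\<beta> * G = (\<alpha> * F + \<beta> * G + \<gamma> * H) - \<alpha> * F - \<gamma> * H"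
    "\<beta>' * G = (\<alpha>' * F + \<beta>' * G + \<gamma>' * H) - \<alpha>' * F - \<gamma>' * H"
    "\<gamma> * H = (\<alpha> * F + \<beta> * G + \<gamma> * H) - \<alpha> * F - \<beta> * G"
    "\<gamma>' * H = (\<alpha>' * F + \<beta>' * G + \<gamma>' * H) - \<alpha>' * F - \<beta>' * G"
    by simp_all
  then have elim: "\<beta> * G = - \<alpha> * F - \<gamma> * H" "\<beta>' * G = - \<alpha>' * F - \<gamma>' * H"
    "\<gamma> * H = - \<alpha> * F - \<beta> * G" "\<gamma>' * H = - \<alpha>' * F - \<beta>' * G"
    unfolding eqs by simp_all
  have "X * G = \<gamma>' * (\<beta> * G) - \<gamma> * (\<beta>' * G)"
    by (simp add: XYZ algebra_simps)
  also have "\<dots> = F * Y"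
    unfolding elim(1,2) by (simp add: XYZ algebra_simps)
  finally have XG: "X * G = F * Y" .
  have "X * H = \<beta> * (\<gamma>' * H) - \<beta>' * (\<gamma> * H)"
    by (simp add: XYZ algebra_simps)
  also have "\<dots> = F * Z"
    unfolding elim(3,4) by (simp add: XYZ algebra_simps)
  finally have XH: "X * H = F * Z" .
  have "F dvd X"
    using no_common_factor_dvd[OF ncf, of F X] XG XH by (metis dvd_triv_left dvd_triv_right)
  then obtain h where h: "X = F * h" ..
  have Y: "Y = h * G" and Z: "Z = h * H"
    using XG XH h nz by (auto simp: ac_simps)
  have "h = 0"
  proof (rule ccontr)
    assume "h \<noteq> 0"
    (* X G H is a combination of products of the entries of the two relations, hence homogeneous
       of degree d + d'. *)
    have "h * (F * G * H) = X * (G * H)"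
      using h by (simp add: ac_simps)
    also have "\<dots> = (\<beta> * G) * (\<gamma>' * H) - (\<gamma> * H) * (\<beta>' * G)"
      by (simp add: XYZ algebra_simps)
    finally have "h * (F * G * H) = (\<beta> * G) * (\<gamma>' * H) - (\<gamma> * H) * (\<beta>' * G)" .
    then have "homog_deg (d + d') (h * (F * G * H))"
      using syz by (simp add: homog_deg_diff homog_deg_mult)
    then obtain e e' where e: "homog_deg e' (F * G * H)" "d + d' = e + e'"
      using homog_deg_mult_imp_factors[of "d + d'" h "F * G * H"] \<open>h \<noteq> 0\<close> nz by auto
    have "homog_deg (deg_sum F G H) (F * G * H)"
      using hom nz by (intro homog_deg_mult homog_deg_total_deg)
    then have "e' = deg_sum F G H"
      using e nz by (intro homog_deg_unique[of e' "F * G * H"]) auto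
    with less e show False by linarith
  qed
  then have "\<alpha> * \<beta>' = \<beta> * \<alpha>'" "\<alpha> * \<gamma>' = \<gamma> * \<alpha>'" "\<beta> * \<gamma>' = \<gamma> * \<beta>'"
    using h Y Z unfolding XYZ by auto
  then obtain c where c: "\<alpha>' = c * \<alpha>" "\<beta>' = c * \<beta>" "\<gamma>' = c * \<gamma>"
    using parallel_multiple[OF S(2)] by blast
  have le: "d \<le> d'" if "homog_deg d' (c * P * F')" "homog_deg d (P * F')" "P \<noteq> 0" "F' \<noteq> 0" for P F'
  proof -
    have "c \<noteq> 0" using S'(2) c by auto
    with that obtain e e' where "homog_deg e' (P * F')" "d' = e + e'"
      using homog_deg_mult_imp_factors[of d' c "P * F'"] by (auto simp: mult.assoc)
    with that homog_deg_unique[of e' "P * F'" d] show ?thesis by simp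
  qed
  have "\<alpha> \<noteq> 0 \<or> \<beta> \<noteq> 0 \<or> \<gamma> \<noteq> 0" using no_common_factor_nonzero S(2) by blast
  with le syz nz c have "d \<le> d'" by blast
  with \<open>\<not> d \<le> d'\<close> show False ..
qed

lemma min_syzygy_deg_le:
  "homog_syzygy d F G H S \<Longrightarrow> S \<noteq> (0, 0, 0) \<Longrightarrow> min_syzygy_deg F G H \<le> d"
  unfolding min_syzygy_deg_def by (rule Least_le) blast

lemma min_syzygy_deg_eq:
  assumes "coprime_forms F G H" "homog_syzygy d F G H (\<alpha>, \<beta>, \<gamma>)"
    and "no_common_factor \<alpha> \<beta> \<gamma>" "2 * d \<le> deg_sum F G H"
  shows "min_syzygy_deg F G H = d"
  unfolding min_syzygy_deg_def
proof (rule Least_equality)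
  show "\<exists>S. S \<noteq> (0, 0, 0) \<and> homog_syzygy d F G H S"
    using assms no_common_factor_nonzero[OF assms(3)] by fastforce
  show "d \<le> d'" if "\<exists>S. S \<noteq> (0, 0, 0) \<and> homog_syzygy d' F G H S" for d'
    using that primitive_syzygy_minimal[OF assms] by (metis prod_cases3)
qed

text \<open>A common factor of the entries could be divided out, which lowers the degree unless it is a unit.\<close>
lemma primitive_of_minimal:
  fixes F G H :: "'a::field poly poly"
  assumes nz: "F \<noteq> 0" "G \<noteq> 0" "H \<noteq> 0"
    and S: "homog_syzygy d F G H (\<alpha>, \<beta>, \<gamma>)" "(\<alpha>, \<beta>, \<gamma>) \<noteq> (0, 0, 0)"
    and min: "\<And>d' S'. homog_syzygy d' F G H S' \<Longrightarrow> S' \<noteq> (0, 0, 0) \<Longrightarrow> d \<le> d'"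
  shows "no_common_factor \<alpha> \<beta> \<gamma>"
  unfolding no_common_factor_def
proof (intro allI impI)
  fix D assume "D dvd \<alpha>" "D dvd \<beta>" "D dvd \<gamma>"
  then obtain \<alpha>' \<beta>' \<gamma>' where c: "\<alpha> = D * \<alpha>'" "\<beta> = D * \<beta>'" "\<gamma> = D * \<gamma>'"
    by (elim dvdE)
  have D0: "D \<noteq> 0" using S(2) c by auto
  note syz = S(1)[unfolded homog_syzygy_iff[OF nz]]
  have fac: "\<exists>e e'. homog_deg e D \<and> d = e + e'" if "homog_deg d (D * P * F')" "D * P * F' \<noteq> 0" for P F'
    using homog_deg_mult_imp_factors[of d D "P * F'"] that by (auto simp: mult.assoc)
  have "\<alpha> \<noteq> 0 \<or> \<beta> \<noteq> 0 \<or> \<gamma> \<noteq> 0" using S(2) by auto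
  then have "\<exists>e e'. homog_deg e D \<and> d = e + e'"
    using fac syz c nz by (metis mult_eq_0_iff)
  then obtain e e' where e: "homog_deg e D" "d = e + e'" by blast
  have "D * (\<alpha>' * F + \<beta>' * G + \<gamma>' * H) = 0"
    using syz c by (simp add: algebra_simps)
  then have "\<alpha>' * F + \<beta>' * G + \<gamma>' * H = 0" using D0 by simp
  moreover have "homog_deg e' (\<alpha>' * F)" "homog_deg e' (\<beta>' * G)" "homog_deg e' (\<gamma>' * H)"
    using syz c homog_deg_cancel_left[OF _ e(1) D0] e(2) by (auto simp: mult.assoc)
  ultimately have "homog_syzygy e' F G H (\<alpha>', \<beta>', \<gamma>')"
    using homog_syzygy_iff[OF nz] by blast
  moreover have "(\<alpha>', \<beta>', \<gamma>') \<noteq> (0, 0, 0)" using S(2) c by auto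
  ultimately have "d \<le> e'" using min by blast
  then have "e = 0" using e by simp
  then show "D dvd 1" using e D0 homog_deg_0_imp_unit by blast
qed

section \<open>Existence of short syzygies, and the Frobenius map\<close>

text \<open>For families instead of sets of vectors: repeated members are a dependence of their own.\<close>
lemma (in vector_space) family_in_small_span_dependent:
  assumes "finite I" "finite T" "\<And>i. i \<in> I \<Longrightarrow> A i \<in> span T" "card T < card I"
  shows "\<exists>c. (\<exists>i\<in>I. c i \<noteq> 0) \<and> (\<Sum>i\<in>I. scale (c i) (A i)) = 0"
proof (cases "inj_on A I")
  case True
  then have "card T < card (A ` I)" using assms(4) by (simp add: card_image)
  moreover have "A ` I \<subseteq> span T" using assms(3) by blast
  ultimately have "dependent (A ` I)"
    using independent_span_bound[OF assms(2), of "A ` I"] by linarith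
  then obtain u where u: "\<exists>v\<in>A ` I. u v \<noteq> 0" "(\<Sum>v\<in>A ` I. scale (u v) v) = 0"
    using dependent_finite[of "A ` I"] assms(1) by auto
  have "(\<Sum>i\<in>I. scale (u (A i)) (A i)) = 0"
    using u(2) by (simp add: sum.reindex[OF True])
  then show ?thesis using u(1) by (intro exI[of _ "u \<circ> A"]) auto
next
  case False
  then obtain i j where ij: "i \<in> I" "j \<in> I" "i \<noteq> j" "A i = A j"
    by (auto simp: inj_on_def)
  let ?c = "\<lambda>k. if k = i then 1 else if k = j then - 1 else 0"
  have "(\<Sum>k\<in>I. scale (?c k) (A k)) = (\<Sum>k\<in>{i, j}. scale (?c k) (A k))"
    using assms(1) ij by (intro sum.mono_neutral_right) auto
  also have "\<dots> = 0" using ij by simp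
  finally show ?thesis using ij by (intro exI[of _ ?c]) auto
qed

definition binary_form :: "nat \<Rightarrow> (nat \<Rightarrow> 'a::field) \<Rightarrow> 'a poly poly" where
  "binary_form n a = (\<Sum>i\<le>n. smult [:a i:] (monom (monom 1 i) (n - i)))"

lemma coeff_binary_form: "coeff (coeff (binary_form n a) j) i = (if i + j = n then a i else 0)"
proof -
  have "coeff (coeff (smult [:a k:] (monom (monom 1 k) (n - k))) j) i =
          (if k = i then (if n - k = j then a k else 0) else 0)" for k
    by (simp add: smult_monom)
  then have "coeff (coeff (binary_form n a) j) i = (\<Sum>k\<le>n. if k = i then (if n - k = j then a k else 0) else 0)"
    unfolding binary_form_def coeff_sum by (rule sum.cong[OF refl])
  also have "\<dots> = (if i \<le> n then (if n - i = j then a i else 0) else 0)"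
    by (subst sum.delta) auto
  also have "\<dots> = (if i + j = n then a i else 0)" by auto
  finally show ?thesis .
qed

lemma homog_deg_binary_form: "homog_deg n (binary_form n a)"
  by (simp add: homog_deg_def coeff_binary_form)

lemma homog_deg_monom: "homog_deg (i + j) (monom (monom c i) j)"
  by (auto simp: homog_deg_def split: if_splits)

lemma binary_form_of_homog_deg:
  assumes "homog_deg d P"
  shows "P = binary_form d (\<lambda>i. coeff (coeff P (d - i)) i)"
proof (intro poly_eqI)
  fix j i
  have "coeff (coeff P j) i = 0" if "i + j \<noteq> d"
    using assms that unfolding homog_deg_def by blast
  then show "coeff (coeff P j) i = coeff (coeff (binary_form d (\<lambda>i. coeff (coeff P (d - i)) i)) j) i"
    by (auto simp: coeff_binary_form)
qed

text \<open>
  The forms \<open>\<alpha>\<close>, \<open>\<beta>\<close>, \<open>\<gamma>\<close> of degrees \<open>d - f\<close>, \<open>d - g\<close>, \<open>d - h\<close> have \<open>3 d + 3 - (f + g + h)\<close> coefficients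
  in total, and the relation imposes \<open>d + 1\<close> linear conditions on them. By the bound on \<open>f + g + h\<close>
  there are more coefficients than conditions.
\<close>
lemma short_syzygy_by_counting:
  fixes F G H :: "'a::field poly poly"
  assumes hom: "homog_deg f F" "homog_deg g G" "homog_deg h H"
    and le: "f \<le> d" "g \<le> d" "h \<le> d" and d: "f + g + h \<le> 2 * d + 1"
  shows "\<exists>\<alpha> \<beta> \<gamma>. (\<alpha>, \<beta>, \<gamma>) \<noteq> (0, 0, 0) \<and> \<alpha> * F + \<beta> * G + \<gamma> * H = 0 \<and>
           homog_deg d (\<alpha> * F) \<and> homog_deg d (\<beta> * G) \<and> homog_deg d (\<gamma> * H)"
proof -
  interpret vs: vector_space "\<lambda>(c::'a) (P::'a poly poly). smult [:c:] P"
    by unfold_locales (simp_all add: smult_add_right mult.commute flip: smult_add_left)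
  define T :: "'a poly poly set" where "T = (\<lambda>i. monom (monom 1 i) (d - i)) ` {..d}"
  have T: "finite T" "card T \<le> d + 1"
    unfolding T_def using card_image_le[of "{..d}"] by auto
  have span: "P \<in> vs.span T" if P: "homog_deg d P" for P
  proof -
    have "binary_form d a \<in> vs.span T" for a
      unfolding binary_form_def by (intro vs.span_sum vs.span_scale vs.span_base) (auto simp: T_def)
    then show ?thesis by (subst binary_form_of_homog_deg[OF P])
  qed
  define I where "I = {..d - f} <+> ({..d - g} <+> {..d - h})"
  define A where "A = case_sum (\<lambda>i. monom (monom 1 i) (d - f - i) * F)
    (case_sum (\<lambda>i. monom (monom 1 i) (d - g - i) * G) (\<lambda>i. monom (monom 1 i) (d - h - i) * H))"
  have summand: "homog_deg d (monom (monom 1 i) (d - e - i) * P)" if "homog_deg e P" "e \<le> d" "i \<le> d - e"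
    for i e and P :: "'a poly poly"
    using homog_deg_mult[OF homog_deg_monom[of i "d - e - i" 1] that(1)] that by simp
  have "A i \<in> vs.span T" if "i \<in> I" for i
    using that unfolding I_def A_def by (auto simp del: diff_diff_left intro!: span summand hom le)
  moreover have "card T < card I"
    using T(2) d le by (simp add: I_def card_Plus)
  moreover have "finite I" by (simp add: I_def)
  ultimately obtain c where c: "\<exists>i\<in>I. c i \<noteq> 0" "(\<Sum>i\<in>I. smult [:c i:] (A i)) = 0"
    using vs.family_in_small_span_dependent[of I T A] T(1) by auto
  define \<alpha> \<beta> \<gamma> where "\<alpha> = binary_form (d - f) (\<lambda>i. c (Inl i))" "\<beta> = binary_form (d - g) (\<lambda>i. c (Inr (Inl i)))"
    "\<gamma> = binary_form (d - h) (\<lambda>i. c (Inr (Inr i)))"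
  note defs = this
  have "(\<Sum>i\<in>I. smult [:c i:] (A i)) = \<alpha> * F + \<beta> * G + \<gamma> * H"
    by (simp add: I_def A_def defs binary_form_def sum.Plus sum_distrib_right add.assoc)
  then have "\<alpha> * F + \<beta> * G + \<gamma> * H = 0" using c(2) by simp
  moreover have "homog_deg d (\<alpha> * F)" "homog_deg d (\<beta> * G)" "homog_deg d (\<gamma> * H)"
    using homog_deg_mult[OF homog_deg_binary_form hom(1)] homog_deg_mult[OF homog_deg_binary_form hom(2)]
      homog_deg_mult[OF homog_deg_binary_form hom(3)] le unfolding defs by (metis le_add_diff_inverse2)+
  moreover have "(\<alpha>, \<beta>, \<gamma>) \<noteq> (0, 0, 0)"
  proof -
    have form_nz: "binary_form n a \<noteq> 0" if "a i \<noteq> 0" "i \<le> n" for n i and a :: "nat \<Rightarrow> 'a"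
      using that coeff_binary_form[of n a "n - i" i] by auto
    from c(1) obtain i where i: "i \<in> I" "c i \<noteq> 0" by blast
    then show ?thesis
      unfolding I_def defs using form_nz by (auto elim!: PlusE)
  qed
  ultimately show ?thesis by blast
qed

text \<open>
  Counting fails only if one of the three degrees exceeds half of the sum; then the Koszul syzygy of
  the other two polynomials is short enough.
\<close>
lemma short_syzygy_exists:
  assumes nz: "F \<noteq> 0" "G \<noteq> 0" "H \<noteq> 0" and hom: "homog F" "homog G" "homog H"
  shows "\<exists>d S. S \<noteq> (0, 0, 0) \<and> homog_syzygy d F G H S \<and> 2 * d \<le> deg_sum F G H"
proof -
  let ?f = "total_deg F" and ?g = "total_deg G" and ?h = "total_deg H"
  note degs = homog_deg_total_deg[OF hom(1) nz(1)] homog_deg_total_deg[OF hom(2) nz(2)]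
    homog_deg_total_deg[OF hom(3) nz(3)]
  define d where "d = (?f + ?g + ?h) div 2"
  have d: "2 * d \<le> deg_sum F G H" "deg_sum F G H \<le> 2 * d + 1"
    unfolding d_def by presburger+
  consider "d < ?f" | "d < ?g" | "d < ?h" | "?f \<le> d" "?g \<le> d" "?h \<le> d" by linarith
  then show ?thesis
  proof cases
    case 1
    have "homog_syzygy (?g + ?h) F G H (0, H, - G)"
      using homog_deg_mult[OF degs(2,3)]
      by (simp add: homog_syzygy_iff[OF nz] homog_deg_uminus ac_simps)
    moreover have "2 * (?g + ?h) \<le> deg_sum F G H" using 1 d by (simp add: algebra_simps)
    ultimately show ?thesis using nz by blast
  next
    case 2
    have "homog_syzygy (?f + ?h) F G H (H, 0, - F)"
      using homog_deg_mult[OF degs(1,3)]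
      by (simp add: homog_syzygy_iff[OF nz] homog_deg_uminus ac_simps)
    moreover have "2 * (?f + ?h) \<le> deg_sum F G H" using 2 d by (simp add: algebra_simps)
    ultimately show ?thesis using nz by blast
  next
    case 3
    have "homog_syzygy (?f + ?g) F G H (G, - F, 0)"
      using homog_deg_mult[OF degs(1,2)]
      by (simp add: homog_syzygy_iff[OF nz] homog_deg_uminus ac_simps)
    moreover have "2 * (?f + ?g) \<le> deg_sum F G H" using 3 d by (simp add: algebra_simps)
    ultimately show ?thesis using nz by blast
  next
    case 4
    from short_syzygy_by_counting[OF degs 4 d(2)]
    obtain \<alpha> \<beta> \<gamma> where "(\<alpha>, \<beta>, \<gamma>) \<noteq> (0, 0, 0)" "homog_syzygy d F G H (\<alpha>, \<beta>, \<gamma>)"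
      unfolding homog_syzygy_iff[OF nz] by blast
    then show ?thesis using d(1) by (intro exI conjI)
  qed
qed

lemma minimal_syzygy:
  assumes "coprime_forms F G H"
  obtains \<alpha> \<beta> \<gamma> where "homog_syzygy (min_syzygy_deg F G H) F G H (\<alpha>, \<beta>, \<gamma>)"
    "no_common_factor \<alpha> \<beta> \<gamma>" "2 * min_syzygy_deg F G H \<le> deg_sum F G H"
proof -
  have nz: "F \<noteq> 0" "G \<noteq> 0" "H \<noteq> 0" "homog F" "homog G" "homog H"
    using assms by (auto simp: coprime_forms_def)
  from short_syzygy_exists[OF nz] obtain d S
    where dS: "S \<noteq> (0, 0, 0)" "homog_syzygy d F G H S" "2 * d \<le> deg_sum F G H"
    by (elim exE conjE)
  have "\<exists>S. S \<noteq> (0, 0, 0) \<and> homog_syzygy (min_syzygy_deg F G H) F G H S"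
    unfolding min_syzygy_deg_def
    by (rule LeastI[of "\<lambda>d. \<exists>S. S \<noteq> (0, 0, 0) \<and> homog_syzygy d F G H S" d])
       (use dS in \<open>intro exI[of _ S] conjI\<close>)
  then obtain \<alpha> \<beta> \<gamma> where S: "homog_syzygy (min_syzygy_deg F G H) F G H (\<alpha>, \<beta>, \<gamma>)"
    "(\<alpha>, \<beta>, \<gamma>) \<noteq> (0, 0, 0)"
    by (metis prod_cases3)
  have "no_common_factor \<alpha> \<beta> \<gamma>"
    by (rule primitive_of_minimal[OF nz(1-3) S]) (rule min_syzygy_deg_le)
  moreover have "2 * min_syzygy_deg F G H \<le> deg_sum F G H"
    using min_syzygy_deg_le[OF dS(2,1)] dS(3) by linarith
  ultimately show thesis using S(1) that by simp
qed

lemma syzygy_gap_eq: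
  "syzygy_gap F G H = int (deg_sum F G H) - 2 * int (min_syzygy_deg F G H)"
  by (simp add: syzygy_gap_def)

lemma syzygy_gap_nonneg: "coprime_forms F G H \<Longrightarrow> syzygy_gap F G H \<ge> 0"
  unfolding syzygy_gap_eq by (erule minimal_syzygy) linarith

lemma homog_power: "homog P \<Longrightarrow> homog (P ^ n)"
  for P :: "'a::comm_ring_1 poly poly"
  unfolding homog_def using homog_deg_power by blast

lemma total_deg_power:
  fixes P :: "'a::idom poly poly"
  assumes "homog P" "P \<noteq> 0"
  shows "total_deg (P ^ n) = n * total_deg P"
  using homog_deg_power[OF homog_deg_total_deg[OF assms], of n] assms by (simp add: total_deg_eq)

lemma coprime_forms_power: "coprime_forms F G H \<Longrightarrow> coprime_forms (F ^ n) (G ^ n) (H ^ n)"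
  by (simp add: coprime_forms_def homog_power no_common_factor_power)

lemma homog_syzygy_frobenius:
  fixes F G H :: "'a::field poly poly"
  assumes prime: "prime CHAR('a)" and Q: "Q = CHAR('a) ^ s"
    and nz: "F \<noteq> 0" "G \<noteq> 0" "H \<noteq> 0"
    and S: "homog_syzygy d F G H (\<alpha>, \<beta>, \<gamma>)"
  shows "homog_syzygy (Q * d) (F ^ Q) (G ^ Q) (H ^ Q) (\<alpha> ^ Q, \<beta> ^ Q, \<gamma> ^ Q)"
proof -
  note syz = S[unfolded homog_syzygy_iff[OF nz]]
  have CH: "prime CHAR('a poly poly)" "Q = CHAR('a poly poly) ^ s"
    using prime Q by simp_all
  have "Q > 0" using prime Q by (simp add: prime_gt_0_nat)
  have "(\<alpha> * F + \<beta> * G + \<gamma> * H) ^ Q = (\<alpha> * F) ^ Q + (\<beta> * G) ^ Q + (\<gamma> * H) ^ Q"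
    by (simp only: freshmans_dream'[OF CH])
  then have "(\<alpha> * F) ^ Q + (\<beta> * G) ^ Q + (\<gamma> * H) ^ Q = 0"
    using syz \<open>Q > 0\<close> by (simp add: power_0_left)
  moreover have "homog_deg (Q * d) ((\<alpha> * F) ^ Q)" "homog_deg (Q * d) ((\<beta> * G) ^ Q)"
    "homog_deg (Q * d) ((\<gamma> * H) ^ Q)"
    using syz homog_deg_power by blast+
  ultimately show ?thesis
    using nz by (simp add: homog_syzygy_iff power_mult_distrib)
qed

text \<open>
  The power of a primitive short syzygy is again primitive and short, hence minimal for the powers.
\<close>
lemma syzygy_gap_frobenius:
  fixes F G H :: "'a::field poly poly"
  assumes "prime CHAR('a)" "Q = CHAR('a) ^ s" "coprime_forms F G H"
  shows "syzygy_gap (F ^ Q) (G ^ Q) (H ^ Q) = int Q * syzygy_gap F G H"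
proof -
  have nz: "F \<noteq> 0" "G \<noteq> 0" "H \<noteq> 0" "homog F" "homog G" "homog H"
    using assms by (auto simp: coprime_forms_def)
  obtain \<alpha> \<beta> \<gamma> where S: "homog_syzygy (min_syzygy_deg F G H) F G H (\<alpha>, \<beta>, \<gamma>)"
    "no_common_factor \<alpha> \<beta> \<gamma>" "2 * min_syzygy_deg F G H \<le> deg_sum F G H"
    by (rule minimal_syzygy[OF assms(3)])
  have degs: "deg_sum (F ^ Q) (G ^ Q) (H ^ Q) = Q * deg_sum F G H"
    using nz by (simp add: total_deg_power distrib_left)
  have "2 * (Q * min_syzygy_deg F G H) \<le> deg_sum (F ^ Q) (G ^ Q) (H ^ Q)"
    unfolding degs using mult_le_mono2[OF S(3), of Q] by (simp only: mult.left_commute)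
  then have "min_syzygy_deg (F ^ Q) (G ^ Q) (H ^ Q) = Q * min_syzygy_deg F G H"
    using coprime_forms_power[OF assms(3)] no_common_factor_power[OF S(2)]
      homog_syzygy_frobenius[OF assms(1,2) nz(1-3) S(1)]
    by (intro min_syzygy_deg_eq)
  then show ?thesis
    unfolding syzygy_gap_eq degs by (simp add: right_diff_distrib)
qed

section \<open>Directional derivatives\<close>

text \<open>The derivation \<open>r \<partial>/\<partial>x + s \<partial>/\<partial>y\<close>; the inner variable is \<open>x\<close>.\<close>
definition dir_deriv :: "'a::field \<Rightarrow> 'a \<Rightarrow> 'a poly poly \<Rightarrow> 'a poly poly" where
  "dir_deriv r s P = smult [:r:] (map_poly pderiv P) + smult [:s:] (pderiv P)"

lemma coeff_dir_deriv:
  "coeff (coeff (dir_deriv r s P) j) i =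
     r * (of_nat (Suc i) * coeff (coeff P j) (Suc i)) + s * (of_nat (Suc j) * coeff (coeff P (Suc j)) i)"
proof -
  have "coeff (of_nat n * c) k = of_nat n * coeff c k" for n k and c :: "'a poly"
    by (simp add: of_nat_poly)
  then show ?thesis
    by (simp add: dir_deriv_def coeff_map_poly coeff_pderiv del: of_nat_Suc)
qed

lemma dir_deriv_0 [simp]: "dir_deriv r s 0 = 0"
  by (simp add: dir_deriv_def)

lemma dir_deriv_add: "dir_deriv r s (P + Q) = dir_deriv r s P + dir_deriv r s Q"
  by (intro poly_eqI) (simp add: coeff_dir_deriv algebra_simps)

lemma map_poly_pderiv_mult:
  fixes P Q :: "'a::field poly poly"
  shows "map_poly pderiv (P * Q) = map_poly pderiv P * Q + P * map_poly pderiv Q"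
proof (induction P)
  case (pCons c P)
  have cons: "map_poly pderiv (pCons c P) = pCons (pderiv c) (map_poly pderiv P)" for c :: "'a poly" and P
    by (intro poly_eqI) (simp add: coeff_map_poly coeff_pCons split: nat.splits)
  have add: "map_poly pderiv (P + Q) = map_poly pderiv P + map_poly pderiv Q" for P Q :: "'a poly poly"
    by (intro poly_eqI) (simp add: coeff_map_poly pderiv_add)
  have smult: "map_poly pderiv (smult c Q) = smult (pderiv c) Q + smult c (map_poly pderiv Q)"
    by (intro poly_eqI) (simp add: coeff_map_poly pderiv_mult algebra_simps)
  show ?case
    by (simp add: mult_pCons_left add smult cons pCons.IH algebra_simps)
qed simp

lemma dir_deriv_mult: "dir_deriv r s (P * Q) = dir_deriv r s P * Q + P * dir_deriv r s Q"
  by (simp add: dir_deriv_def map_poly_pderiv_mult pderiv_mult algebra_simps smult_add_right)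

lemma dir_deriv_1 [simp]: "dir_deriv r s 1 = 0"
  by (intro poly_eqI) (auto simp: coeff_dir_deriv coeff_1)

lemma dir_deriv_power:
  "dir_deriv r s (P ^ n) = of_nat n * P ^ (n - 1) * dir_deriv r s P"
proof (induction n)
  case (Suc n)
  then show ?case
    by (cases n) (simp_all add: dir_deriv_mult algebra_simps)
qed simp

lemma dir_deriv_power_char:
  fixes P :: "'a::field poly poly"
  assumes "CHAR('a) dvd n"
  shows "dir_deriv r s (P ^ n) = 0"
proof -
  have "of_nat n = (0 :: 'a poly poly)"
    using assms by (simp add: of_nat_eq_0_iff_char_dvd)
  then show ?thesis by (simp add: dir_deriv_power)
qed

text \<open>
  Each term of the Leibniz expansion differentiates one factor and keeps the others. With \<open>f i = l\<^sub>i^a\<^sub>i\<close>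
  this shows how far the exponents drop under differentiation.
\<close>
lemma prod_dvd_dir_deriv_prod:
  assumes "\<And>i. i \<in> A \<Longrightarrow> g i dvd f i" "\<And>i. i \<in> A \<Longrightarrow> g i dvd dir_deriv r s (f i)"
  shows "(\<Prod>i\<in>A. g i) dvd dir_deriv r s (\<Prod>i\<in>A. f i)"
  using assms
proof (induction A rule: infinite_finite_induct)
  case (insert i A)
  then show ?case
    by (simp add: dir_deriv_mult) (intro dvd_add mult_dvd_mono prod_dvd_prod; simp)
qed simp_all

lemma homog_deg_dir_deriv:
  assumes "homog_deg d P"
  shows "homog_deg (d - 1) (dir_deriv r s P)"
  unfolding homog_deg_def
proof (intro allI impI)
  fix i j assume "coeff (coeff (dir_deriv r s P) j) i \<noteq> 0"
  then have "coeff (coeff P j) (Suc i) \<noteq> 0 \<or> coeff (coeff P (Suc j)) i \<noteq> 0"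
    unfolding coeff_dir_deriv by auto
  then have "Suc i + j = d \<or> i + Suc j = d"
    using assms unfolding homog_deg_def by blast
  then show "i + j = d - 1" by auto
qed

lemma dir_deriv_homog_deg_0:
  assumes "homog_deg 0 P"
  shows "dir_deriv r s P = 0"
proof (intro poly_eqI)
  fix j i
  have "coeff (coeff P j) (Suc i) = 0" "coeff (coeff P (Suc j)) i = 0"
    using assms unfolding homog_deg_def by force+
  then show "coeff (coeff (dir_deriv r s P) j) i = coeff (coeff 0 j) i"
    unfolding coeff_dir_deriv by simp
qed

lemma dir_deriv_linear_form:
  assumes "linear_form L"
  shows "dir_deriv r s L = [:[:r * coeff (coeff L 0) 1 + s * coeff (coeff L 1) 0:]:]"
proof (intro poly_eqI)
  fix j i
  have "coeff (coeff L j) i = 0" if "i + j \<noteq> 1" for i j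
    using assms that unfolding linear_form_def homog_deg_def by blast
  then show "coeff (coeff (dir_deriv r s L) j) i =
      coeff (coeff [:[:r * coeff (coeff L 0) 1 + s * coeff (coeff L 1) 0:]:] j) i"
    unfolding coeff_dir_deriv by (cases i; cases j) auto
qed

lemma linear_form_coeffs_nonzero:
  assumes "linear_form L"
  shows "coeff (coeff L 0) 1 \<noteq> 0 \<or> coeff (coeff L 1) 0 \<noteq> 0"
proof -
  have "L \<noteq> 0" using assms by (simp add: linear_form_def)
  then obtain i j where ij: "coeff (coeff L j) i \<noteq> 0"
    by (rule nonzero_coeff_exists)
  then have "i + j = 1" using assms unfolding linear_form_def homog_deg_def by blast
  then have "i = 1 \<and> j = 0 \<or> i = 0 \<and> j = 1" by linarith
  with ij show ?thesis by auto
qed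

lemma dir_deriv_nonzero_exists:
  assumes "linear_form L"
  shows "\<exists>r s. dir_deriv r s L \<noteq> 0"
proof -
  have "dir_deriv 1 0 L \<noteq> 0 \<or> dir_deriv 0 1 L \<noteq> 0"
    using linear_form_coeffs_nonzero[OF assms] by (auto simp: dir_deriv_linear_form[OF assms])
  then show ?thesis by blast
qed

text \<open>
  For \<open>L = u x + v y\<close> the direction \<open>(v, -u)\<close> kills \<open>L\<close>, and among the linear forms it
  kills only the scalar multiples of \<open>L\<close>.
\<close>
lemma dir_deriv_separates:
  fixes L L' :: "'a::field poly poly"
  assumes L: "linear_form L" "linear_form L'" and "\<not> L dvd L'"
  shows "\<exists>r s. dir_deriv r s L = 0 \<and> dir_deriv r s L' \<noteq> 0"
proof -
  define u v u' v' where uv: "u = coeff (coeff L 0) 1" "v = coeff (coeff L 1) 0"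
    "u' = coeff (coeff L' 0) 1" "v' = coeff (coeff L' 1) 0"
  have "dir_deriv v (- u) L = 0"
    using L(1) by (simp add: dir_deriv_linear_form uv)
  moreover have "dir_deriv v (- u) L' \<noteq> 0"
  proof
    assume "dir_deriv v (- u) L' = 0"
    then have vu: "v * u' = u * v'"
      using L(2) by (simp add: dir_deriv_linear_form uv)
    obtain c where c: "u' = c * u" "v' = c * v"
    proof (cases "u = 0")
      case True
      then have "v \<noteq> 0" using linear_form_coeffs_nonzero[OF L(1)] uv by simp
      then show thesis using that[of "v' / v"] vu True by simp
    next
      case False
      then show thesis using that[of "u' / u"] vu by (simp add: field_simps)
    qed

    have "L' = smult [:c:] L"
    proof (intro poly_eqI)
      fix j i
      have "coeff (coeff M j) i = (if i = 1 \<and> j = 0 then coeff (coeff M 0) 1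
          else if i = 0 \<and> j = 1 then coeff (coeff M 1) 0 else 0)" if "linear_form M" for M :: "'a poly poly"
      proof (cases "i + j = 1")
        case True
        then have "i = 1 \<and> j = 0 \<or> i = 0 \<and> j = 1" by linarith
        then show ?thesis by auto
      next
        case False
        then have "coeff (coeff M j) i = 0"
          using that unfolding linear_form_def homog_deg_def by blast
        then show ?thesis using False by auto
      qed
      then show "coeff (coeff L' j) i = coeff (coeff (smult [:c:] L) j) i"
        using L c uv by simp
    qed
    then have "L' = [:[:c:]:] * L" by simp
    then show False using \<open>\<not> L dvd L'\<close> by (metis dvd_triv_right)
  qed
  ultimately show ?thesis by blast
qed

text \<open>
  The derivative of \<open>u L^n\<close> is \<open>L^(n - 1)\<close> times \<open>L D u + n u D L\<close>. As \<open>n D L\<close> is a nonzero constant, \<open>L\<close>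
  divides the first summand in the bracket but not the second.
\<close>
lemma dir_deriv_mult_power_nonzero:
  fixes L u :: "'a::field poly poly"
  assumes L: "linear_form L" "dir_deriv r s L \<noteq> 0" and "\<not> L dvd u" "\<not> CHAR('a) dvd n"
  shows "dir_deriv r s (u * L ^ n) \<noteq> 0"
proof
  assume zero: "dir_deriv r s (u * L ^ n) = 0"
  obtain n' where n: "n = Suc n'" using assms(4) by (cases n) auto
  have L0: "L \<noteq> 0" using L by (simp add: linear_form_def)
  have "dir_deriv r s (u * L ^ n) = dir_deriv r s u * L ^ n + u * (of_nat n * L ^ n' * dir_deriv r s L)"
    by (simp only: dir_deriv_mult dir_deriv_power n diff_Suc_1)
  also have "\<dots> = L ^ n' * (dir_deriv r s u * L + of_nat n * (u * dir_deriv r s L))"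
    by (simp add: n algebra_simps del: of_nat_Suc)
  finally have "dir_deriv r s u * L + of_nat n * (u * dir_deriv r s L) = 0"
    using zero L0 by simp
  then have "L * (- dir_deriv r s u) = (of_nat n * dir_deriv r s L) * u"
    by (simp add: algebra_simps eq_neg_iff_add_eq_0 neg_eq_iff_add_eq_0)
  then have "L dvd (of_nat n * dir_deriv r s L) * u"
    by (metis dvd_triv_left)
  moreover have "is_unit (of_nat n * dir_deriv r s L)"
  proof (rule homog_deg_0_imp_unit)
    have "homog_deg 0 (dir_deriv r s L)"
      using homog_deg_dir_deriv[of 1 L] L(1) by (simp add: linear_form_def)
    moreover have "homog_deg 0 (of_nat n :: 'a poly poly)"
      by (auto simp: homog_deg_def of_nat_poly coeff_pCons split: nat.splits)
    ultimately show "homog_deg 0 (of_nat n * dir_deriv r s L)"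
      using homog_deg_mult by fastforce
    have "of_nat n \<noteq> (0 :: 'a poly poly)"
      using assms(4) by (simp add: of_nat_eq_0_iff_char_dvd)
    then show "of_nat n * dir_deriv r s L \<noteq> 0" using L(2) by simp
  qed
  ultimately have "L dvd u" by (simp only: dvd_mult_unit_iff' dvd_mult_unit_iff mult.commute[of _ u])
  with assms(3) show False ..
qed

section \<open>Moving factors between a triple and its syzygies\<close>

lemma syzygy_absorb_iff:
  assumes "F \<noteq> 0" "G \<noteq> 0" "H \<noteq> 0" "L \<noteq> 0"
  shows "homog_syzygy d F G (H * L) (\<alpha>, \<beta>, \<gamma>) \<longleftrightarrow> homog_syzygy d F G H (\<alpha>, \<beta>, \<gamma> * L)"
  using assms by (simp add: homog_syzygy_iff ac_simps)

lemma syzygy_cancel_linear_form: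
  assumes nz: "F \<noteq> 0" "G \<noteq> 0" "H \<noteq> 0" and L: "linear_form L"
    and S: "homog_syzygy d F G (H * L) (L * \<alpha>, L * \<beta>, \<gamma>)" "(\<alpha>, \<beta>, \<gamma>) \<noteq> (0, 0, 0)"
  shows "\<exists>e. d = Suc e \<and> homog_syzygy e F G H (\<alpha>, \<beta>, \<gamma>)"
proof -
  have L': "L \<noteq> 0" "homog_deg 1 L" using L by (auto simp: linear_form_def)
  have syz: "L * (\<alpha> * F + \<beta> * G + \<gamma> * H) = 0" "homog_deg d (L * (\<alpha> * F))"
    "homog_deg d (L * (\<beta> * G))" "homog_deg d (L * (\<gamma> * H))"
    using S(1) nz L' by (simp_all add: homog_syzygy_iff algebra_simps)
  have deg: "\<exists>e. d = Suc e" if P: "homog_deg d (L * P)" "P \<noteq> 0" for P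
  proof -
    obtain e e' where e: "homog_deg e L" "d = e + e'"
      using homog_deg_mult_imp_factors[OF P(1)] P(2) L' by auto
    then show ?thesis using homog_deg_unique[OF e(1) L'(2,1)] by simp
  qed
  have "\<alpha> * F \<noteq> 0 \<or> \<beta> * G \<noteq> 0 \<or> \<gamma> * H \<noteq> 0" using S(2) nz by auto
  then obtain e where e: "d = Suc e" using deg syz(2-4) by blast
  then have "homog_deg e (\<alpha> * F)" "homog_deg e (\<beta> * G)" "homog_deg e (\<gamma> * H)"
    using syz(2-4) homog_deg_cancel_left[OF _ L'(2,1)] by simp_all
  then have "homog_syzygy e F G H (\<alpha>, \<beta>, \<gamma>)"
    using syz(1) L'(1) by (simp add: homog_syzygy_iff[OF nz])
  with e show ?thesis by blast
qed

section \<open>The syzygy gaps of a cell at lattice points\<close>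

locale cell =
  fixes l :: "'n::finite \<Rightarrow> 'a::field poly poly" and F G H :: "'a poly poly"
  assumes prime_char: "prime CHAR('a)"
    and linear: "\<And>i. linear_form (l i)"
    and coprime_l: "\<And>i j. i \<noteq> j \<Longrightarrow> coprime (l i) (l j)"
    and cell: "is_cell l (F, G, H)"
begin

definition l_pow :: "('n \<Rightarrow> nat) \<Rightarrow> 'a poly poly" where
  "l_pow a = (\<Prod>i\<in>UNIV. l i ^ a i)"

text \<open>
  The value of the function of the cell at \<open>a / q\<close>, multiplied by \<open>q\<close>. Working with integers at a
  fixed denominator keeps neighbouring points exactly one linear form apart.
\<close>
definition gap :: "nat \<Rightarrow> ('n \<Rightarrow> nat) \<Rightarrow> int" where
  "gap q a = syzygy_gap (F ^ q) (G ^ q) (H ^ q * l_pow a)"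

abbreviation syz :: "nat \<Rightarrow> ('n \<Rightarrow> nat) \<Rightarrow> nat \<Rightarrow> 'a poly poly \<times> 'a poly poly \<times> 'a poly poly \<Rightarrow> bool" where
  "syz q a d S \<equiv> homog_syzygy d (F ^ q) (G ^ q) (H ^ q * l_pow a) S"

definition total :: "nat \<Rightarrow> ('n \<Rightarrow> nat) \<Rightarrow> nat" where
  "total q a = deg_sum (F ^ q) (G ^ q) (H ^ q * l_pow a)"

abbreviation mdeg :: "nat \<Rightarrow> ('n \<Rightarrow> nat) \<Rightarrow> nat" where
  "mdeg q a \<equiv> min_syzygy_deg (F ^ q) (G ^ q) (H ^ q * l_pow a)"

lemma cell_forms:
  "F \<noteq> 0" "G \<noteq> 0" "H \<noteq> 0" "homog F" "homog G" "homog H" "no_common_factor F G (H * (\<Prod>i\<in>UNIV. l i))"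
  using cell by (auto simp: is_cell_def no_common_factor_def)

lemma l_nonzero: "l i \<noteq> 0" and homog_deg_l: "homog_deg 1 (l i)" and prime_l: "prime_elem (l i)"
  using linear[of i] prime_elem_linear_form[of "l i"] by (simp_all add: linear_form_def)

lemma l_not_dvd_l: "i \<noteq> j \<Longrightarrow> \<not> l i dvd l j"
  using coprime_l[of i j] prime_l[of i] coprime_common_divisor[of "l i" "l j" "l i"]
  by (auto simp: prime_elem_def)

lemma l_pow_nonzero: "l_pow a \<noteq> 0"
  by (simp add: l_pow_def l_nonzero)

lemma homog_deg_l_pow: "homog_deg (\<Sum>i\<in>UNIV. a i) (l_pow a)"
  unfolding l_pow_def using homog_deg_power[OF homog_deg_l] by (intro homog_deg_prod) simp

lemma l_pow_add: "l_pow (\<lambda>i. a i + b i) = l_pow a * l_pow b"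
  by (simp add: l_pow_def power_add prod.distrib)

lemma l_pow_of_bool: "l_pow (\<lambda>i. of_bool (i \<in> K)) = (\<Prod>i\<in>K. l i)"
proof -
  have "l_pow (\<lambda>i. of_bool (i \<in> K)) = (\<Prod>i\<in>UNIV. if i \<in> K then l i else 1)"
    unfolding l_pow_def by (intro prod.cong) auto
  also have "\<dots> = (\<Prod>i\<in>K. l i)" by (simp add: prod.If_cases)
  finally show ?thesis .
qed

lemma l_pow_single: "l_pow (\<lambda>j. of_bool (j = i)) = l i"
  using l_pow_of_bool[of "{i}"] by simp

lemma l_pow_power: "l_pow (\<lambda>i. n * a i) = l_pow a ^ n"
  unfolding l_pow_def prod_power_distrib power_mult[symmetric] by (simp add: mult.commute)

lemma l_pow_remove: "l_pow a = (\<Prod>j\<in>UNIV - {i}. l j ^ a j) * l i ^ a i"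
  unfolding l_pow_def by (subst prod.remove[of _ i]) (auto simp: mult.commute)

lemma scaled_nonzero: "F ^ q \<noteq> 0" "G ^ q \<noteq> 0" "H ^ q * l_pow a \<noteq> 0"
  using cell_forms l_pow_nonzero by simp_all

lemma coprime_forms_scaled: "coprime_forms (F ^ q) (G ^ q) (H ^ q * l_pow a)"
proof -
  have "no_common_factor (F ^ q) (G ^ q) (H ^ q * l_pow a)"
  proof (rule no_common_factorI)
    fix \<pi> assume \<pi>: "prime_elem \<pi>" "\<pi> dvd F ^ q" "\<pi> dvd G ^ q" "\<pi> dvd H ^ q * l_pow a"
    have FG: "\<pi> dvd F" "\<pi> dvd G"
      using prime_elem_dvd_power[OF \<pi>(1)] \<pi>(2,3) by simp_all
    consider "\<pi> dvd H ^ q" | "\<pi> dvd l_pow a"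
      using prime_elem_dvd_mult_iff[OF \<pi>(1)] \<pi>(4) by auto
    then have "\<pi> dvd H * (\<Prod>i\<in>UNIV. l i)"
    proof cases
      case 1
      then show ?thesis using prime_elem_dvd_power[OF \<pi>(1)] by simp
    next
      case 2
      then obtain i where "\<pi> dvd l i ^ a i"
        unfolding l_pow_def by (rule prime_elem_dvd_prodE[OF \<pi>(1), rotated]) auto
      then have "\<pi> dvd l i" using prime_elem_dvd_power[OF \<pi>(1)] by simp
      moreover have "l i dvd (\<Prod>i\<in>UNIV. l i)" by (intro dvd_prodI) auto
      ultimately show ?thesis by (meson dvd_mult dvd_trans)
    qed
    then show False by (rule no_common_factor_prime[OF cell_forms(7) \<pi>(1) FG])
  qed (use scaled_nonzero in auto)
  moreover have "homog (H ^ q * l_pow a)"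
    using homog_deg_mult[OF homog_deg_power[OF homog_deg_total_deg[OF cell_forms(6,3)]] homog_deg_l_pow]
    unfolding homog_def by blast
  ultimately show ?thesis
    using scaled_nonzero[of q] cell_forms homog_power[of F q] homog_power[of G q]
    unfolding coprime_forms_def by simp
qed

lemma total_eq: "total q a = q * deg_sum F G H + (\<Sum>i\<in>UNIV. a i)"
proof -
  have "homog_deg (q * total_deg H + (\<Sum>i\<in>UNIV. a i)) (H ^ q * l_pow a)"
    using cell_forms by (intro homog_deg_mult homog_deg_power homog_deg_total_deg homog_deg_l_pow)
  then have "total_deg (H ^ q * l_pow a) = q * total_deg H + (\<Sum>i\<in>UNIV. a i)"
    using scaled_nonzero by (intro total_deg_eq)
  then show ?thesis
    using cell_forms by (simp add: total_def total_deg_power distrib_left)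
qed

lemma total_add: "total q (\<lambda>i. a i + b i) = total q a + (\<Sum>i\<in>UNIV. b i)"
  by (simp add: total_eq sum.distrib)

lemma total_scale: "total (q * Q) (\<lambda>i. Q * a i) = Q * total q a"
  by (simp add: total_eq distrib_left sum_distrib_left mult.commute mult.left_commute)

lemma gap_eq: "gap q a = int (total q a) - 2 * int (mdeg q a)"
  by (simp add: gap_def syzygy_gap_eq total_def)

lemma gap_nonneg: "gap q a \<ge> 0"
  unfolding gap_def by (rule syzygy_gap_nonneg[OF coprime_forms_scaled])

lemma gap_frobenius:
  assumes "Q = CHAR('a) ^ s"
  shows "gap (q * Q) (\<lambda>i. Q * a i) = int Q * gap q a"
  using syzygy_gap_frobenius[OF prime_char assms coprime_forms_scaled[of q a]]
  by (simp add: gap_def power_mult power_mult_distrib l_pow_power)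

lemma syz_frobenius:
  assumes "Q = CHAR('a) ^ s" "syz q a d (\<alpha>, \<beta>, \<gamma>)"
  shows "syz (q * Q) (\<lambda>i. Q * a i) (Q * d) (\<alpha> ^ Q, \<beta> ^ Q, \<gamma> ^ Q)"
  using homog_syzygy_frobenius[OF prime_char assms(1) scaled_nonzero assms(2)]
  by (simp add: power_mult power_mult_distrib l_pow_power)

lemma syz_add_iff:
  "syz q (\<lambda>i. a i + b i) d (\<alpha>, \<beta>, \<gamma>) \<longleftrightarrow> syz q a d (\<alpha>, \<beta>, \<gamma> * l_pow b)"
  using syzygy_absorb_iff[OF scaled_nonzero l_pow_nonzero, of d q q q a b \<alpha> \<beta> \<gamma>]
  by (simp add: l_pow_add ac_simps)

section \<open>Local maxima\<close>

text \<open>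
  If \<open>l i\<close> divides \<open>\<gamma>\<close>, the syzygy \<open>(\<alpha>^Q, \<beta>^Q, \<gamma>^Q)\<close> yields one of the same degree at the upper
  neighbour, where the degree sum is larger by one; so the gap would be larger there.
\<close>
lemma peak_up:
  assumes Q: "Q = CHAR('a) ^ s" and S: "syz q a (mdeg q a) (\<alpha>, \<beta>, \<gamma>)" "(\<alpha>, \<beta>, \<gamma>) \<noteq> (0, 0, 0)"
    and peak: "gap (q * Q) (\<lambda>j. Q * a j + of_bool (j = i)) \<le> int Q * gap q a"
  shows "\<not> l i dvd \<gamma>"
proof
  assume "l i dvd \<gamma>"
  then have "l i dvd \<gamma> ^ Q"
    using Q prime_char by (simp add: dvd_power_iff dvd_power prime_gt_0_nat dvd_trans[OF _ dvd_power])
  then obtain g where g: "\<gamma> ^ Q = g * l i" by (metis dvdE mult.commute)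
  have "syz (q * Q) (\<lambda>j. Q * a j) (Q * mdeg q a) (\<alpha> ^ Q, \<beta> ^ Q, g * l_pow (\<lambda>j. of_bool (j = i)))"
    using syz_frobenius[OF Q S(1)] by (simp add: g l_pow_single)
  then have "syz (q * Q) (\<lambda>j. Q * a j + of_bool (j = i)) (Q * mdeg q a) (\<alpha> ^ Q, \<beta> ^ Q, g)"
    by (simp only: syz_add_iff)
  moreover have "(\<alpha> ^ Q, \<beta> ^ Q, g) \<noteq> (0, 0, 0)"
    using S(2) g l_nonzero[of i] by auto
  ultimately have "mdeg (q * Q) (\<lambda>j. Q * a j + of_bool (j = i)) \<le> Q * mdeg q a"
    by (rule min_syzygy_deg_le)
  moreover have "total (q * Q) (\<lambda>j. Q * a j + of_bool (j = i)) = Q * total q a + 1"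
    by (simp add: total_add total_scale)
  ultimately have "gap (q * Q) (\<lambda>j. Q * a j + of_bool (j = i)) \<ge> int Q * gap q a + 1"
    unfolding gap_eq by (simp add: right_diff_distrib flip: of_nat_mult)
  with peak show False by simp
qed

text \<open>
  If \<open>l i\<close> divides \<open>\<alpha>\<close> and \<open>\<beta>\<close>, cancelling it in \<open>(\<alpha>^Q, \<beta>^Q, \<gamma>^Q)\<close> lowers the degree of the syzygy
  and the degree sum by one each. The former counts twice, so the gap would be larger by one.
\<close>
lemma peak_down:
  assumes Q: "Q = CHAR('a) ^ s" and S: "syz q a (mdeg q a) (\<alpha>, \<beta>, \<gamma>)" "(\<alpha>, \<beta>, \<gamma>) \<noteq> (0, 0, 0)"
    and ai: "a i > 0"
    and peak: "gap (q * Q) (\<lambda>j. Q * a j - of_bool (j = i)) \<le> int Q * gap q a"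
  shows "\<not> (l i dvd \<alpha> \<and> l i dvd \<beta>)"
proof
  assume dvd: "l i dvd \<alpha> \<and> l i dvd \<beta>"
  let ?b = "\<lambda>j. Q * a j - of_bool (j = i)"
  have "Q > 0" using Q prime_char by (simp add: prime_gt_0_nat)
  then have Qa: "(\<lambda>j. Q * a j) = (\<lambda>j. ?b j + of_bool (j = i))"
    using ai by (auto simp: fun_eq_iff Suc_le_eq)
  have "l i dvd \<alpha> ^ Q" "l i dvd \<beta> ^ Q"
    using dvd \<open>Q > 0\<close> dvd_power[of Q] dvd_trans by blast+
  then obtain A B where AB: "\<alpha> ^ Q = l i * A" "\<beta> ^ Q = l i * B" by (elim dvdE)
  have "syz (q * Q) (\<lambda>j. ?b j + of_bool (j = i)) (Q * mdeg q a) (l i * A, l i * B, \<gamma> ^ Q)"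
    using syz_frobenius[OF Q S(1)] by (simp only: AB flip: Qa)
  then have "homog_syzygy (Q * mdeg q a) (F ^ (q * Q)) (G ^ (q * Q))
      ((H ^ (q * Q) * l_pow ?b) * l i) (l i * A, l i * B, \<gamma> ^ Q)"
    by (simp only: l_pow_add l_pow_single mult.assoc)
  moreover have nz: "(A, B, \<gamma> ^ Q) \<noteq> (0, 0, 0)"
    using S(2) AB \<open>Q > 0\<close> by auto
  ultimately obtain e where e: "Q * mdeg q a = Suc e" "syz (q * Q) ?b e (A, B, \<gamma> ^ Q)"
    using syzygy_cancel_linear_form[OF scaled_nonzero linear] by blast
  have "mdeg (q * Q) ?b \<le> e"
    using e(2) nz by (rule min_syzygy_deg_le)
  moreover have "total (q * Q) ?b + 1 = Q * total q a"
  proof -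
    have "total (q * Q) (\<lambda>j. ?b j + of_bool (j = i)) = Q * total q a"
      by (simp only: total_scale flip: Qa)
    then show ?thesis by (simp only: total_add) simp
  qed
  moreover have "int Q * gap q a = int (Q * total q a) - 2 * int (Q * mdeg q a)"
    by (simp add: gap_eq right_diff_distrib)
  ultimately have "gap (q * Q) ?b \<ge> int Q * gap q a + 1"
    unfolding gap_eq[of "q * Q"] using e(1) by linarith
  with peak show False by simp
qed

text \<open>
  The differentiation argument. The hypotheses \<open>up\<close> and \<open>down\<close> are what a local maximum provides: \<open>down\<close>
  keeps the syzygy primitive when the coordinates in \<open>K\<close> are lowered, and \<open>up\<close> makes the multiplicity of
  \<open>l i\<close> in \<open>\<gamma> l^a\<close> equal to \<open>a i\<close>.
\<close>
lemma gap_less_card: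
  assumes q: "CHAR('a) dvd q"
    and S: "syz q a (mdeg q a) (\<alpha>, \<beta>, \<gamma>)" "no_common_factor \<alpha> \<beta> \<gamma>"
    and K: "K = {j. \<not> CHAR('a) dvd a j \<and> dir_deriv r s (l j) \<noteq> 0}" and i: "i \<in> K"
    and up: "\<not> l i dvd \<gamma>"
    and down: "\<And>j. j \<in> K \<Longrightarrow> \<not> (l j dvd \<alpha> \<and> l j dvd \<beta>)"
  shows "gap q a < int (card K)"
proof (rule ccontr)
  assume large: "\<not> gap q a < int (card K)"
  let ?D = "dir_deriv r s" and ?m = "mdeg q a"
  define b where "b = (\<lambda>j. a j - of_bool (j \<in> K))"
  have "a j > 0" if "j \<in> K" for j
    using that unfolding K by (auto intro: Nat.gr0I)
  then have a_eq: "a = (\<lambda>j. b j + of_bool (j \<in> K))"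
    unfolding b_def by (auto simp: fun_eq_iff)
  have "syz q (\<lambda>j. b j + of_bool (j \<in> K)) ?m (\<alpha>, \<beta>, \<gamma>)"
    using S(1) by (simp only: flip: a_eq)
  then have Sb: "syz q b ?m (\<alpha>, \<beta>, \<gamma> * (\<Prod>j\<in>K. l j))"
    by (simp only: syz_add_iff l_pow_of_bool)
  have prim: "no_common_factor \<alpha> \<beta> (\<gamma> * (\<Prod>j\<in>K. l j))"
  proof (rule no_common_factorI)
    show "\<alpha> \<noteq> 0 \<or> \<beta> \<noteq> 0 \<or> \<gamma> * (\<Prod>j\<in>K. l j) \<noteq> 0"
      using no_common_factor_nonzero[OF S(2)] l_nonzero by auto
    fix \<pi> assume \<pi>: "prime_elem \<pi>" "\<pi> dvd \<alpha>" "\<pi> dvd \<beta>" "\<pi> dvd \<gamma> * (\<Prod>j\<in>K. l j)"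
    then have "\<not> \<pi> dvd \<gamma>" using no_common_factor_prime[OF S(2) \<pi>(1-3)] by auto
    then have "\<pi> dvd (\<Prod>j\<in>K. l j)" using prime_elem_dvd_mult_iff[OF \<pi>(1)] \<pi>(4) by auto
    then obtain j where j: "j \<in> K" "\<pi> dvd l j"
      by (rule prime_elem_dvd_prodE[OF \<pi>(1), rotated]) auto
    have "l j dvd \<pi>"
      using irreducibleD'[OF prime_elem_imp_irreducible[OF prime_l] j(2)] \<pi>(1)
      by (auto simp: prime_elem_def)
    from dvd_trans[OF this \<pi>(2)] dvd_trans[OF this \<pi>(3)] show False
      using down[OF j(1)] by simp
  qed
  have total_b: "total q a = total q b + card K"
    by (subst a_eq) (simp only: total_add, simp)
  have "2 * ?m \<le> total q b"
    using large total_b unfolding gap_eq by linarith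
  note short = this[unfolded total_def]
  (* Differentiating l^a loses one factor l j for each j in K and nothing else. *)
  have "(\<Prod>j\<in>UNIV. l j ^ b j) dvd ?D (\<Prod>j\<in>UNIV. l j ^ a j)"
  proof (rule prod_dvd_dir_deriv_prod)
    fix j
    show "l j ^ b j dvd l j ^ a j" by (simp add: b_def le_imp_power_dvd)
    show "l j ^ b j dvd ?D (l j ^ a j)"
    proof (cases "j \<in> K")
      case True
      then show ?thesis by (simp add: b_def dir_deriv_power)
    next
      case False
      then have "?D (l j ^ a j) = 0"
        unfolding K using dir_deriv_power_char[of "a j"] by (auto simp: dir_deriv_power)
      then show ?thesis by simp
    qed
  qed
  then have "l_pow b dvd ?D (\<gamma> * l_pow a)"
    unfolding dir_deriv_mult l_pow_def[symmetric] a_eq[THEN arg_cong[of _ _ l_pow]]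
    by (simp add: l_pow_add)
  then obtain \<gamma>' where \<gamma>': "?D (\<gamma> * l_pow a) = \<gamma>' * l_pow b" by (metis dvdE mult.commute)
  (* As p divides q, the q-th powers are constants for the derivation. *)
  have const: "?D (P * R ^ q) = ?D P * R ^ q" for P R
    using dir_deriv_power_char[OF q] by (simp add: dir_deriv_mult)
  have products: "?D (\<alpha> * F ^ q) = ?D \<alpha> * F ^ q" "?D (\<beta> * G ^ q) = ?D \<beta> * G ^ q"
    "?D (\<gamma> * (H ^ q * l_pow a)) = \<gamma>' * (H ^ q * l_pow b)"
    using const[of "\<gamma> * l_pow a" H] by (simp_all add: const \<gamma>' ac_simps)
  note syzS = S(1)[unfolded homog_syzygy_iff[OF scaled_nonzero]]
  (* The derived syzygy has degree m - 1, too small to be nonzero. For m = 0 the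
     products are constants, so that their derivatives vanish. *)
  have "\<gamma>' = 0"
  proof (cases "?m = 0")
    case True
    then have "\<gamma>' * (H ^ q * l_pow b) = 0"
      using syzS products(3) dir_deriv_homog_deg_0 by metis
    then show ?thesis using scaled_nonzero(3)[of q b] by auto
  next
    case False
    have "?D (\<alpha> * F ^ q + \<beta> * G ^ q + \<gamma> * (H ^ q * l_pow a)) = 0"
      using syzS by simp
    then have "?D \<alpha> * F ^ q + ?D \<beta> * G ^ q + \<gamma>' * (H ^ q * l_pow b) = 0"
      by (simp only: dir_deriv_add products)
    moreover have "homog_deg (?m - 1) (?D \<alpha> * F ^ q)" "homog_deg (?m - 1) (?D \<beta> * G ^ q)"
      "homog_deg (?m - 1) (\<gamma>' * (H ^ q * l_pow b))"
      unfolding products[symmetric] using syzS by (simp_all only: homog_deg_dir_deriv)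
    ultimately have "syz q b (?m - 1) (?D \<alpha>, ?D \<beta>, \<gamma>')"
      by (simp add: homog_syzygy_iff[OF scaled_nonzero])
    then have "(?D \<alpha>, ?D \<beta>, \<gamma>') \<noteq> (0, 0, 0) \<Longrightarrow> ?m \<le> ?m - 1"
      by (rule primitive_syzygy_minimal[OF coprime_forms_scaled Sb prim short])
    moreover have "\<not> ?m \<le> ?m - 1" using False by simp
    ultimately show ?thesis by blast
  qed
  then have "?D (\<gamma> * l_pow a) = 0" using \<gamma>' by simp
  moreover have "\<gamma> * l_pow a = (\<gamma> * (\<Prod>j\<in>UNIV - {i}. l j ^ a j)) * l i ^ a i"
    by (subst l_pow_remove[of a i]) (simp add: ac_simps)
  moreover have "\<not> l i dvd \<gamma> * (\<Prod>j\<in>UNIV - {i}. l j ^ a j)"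
  proof
    assume "l i dvd \<gamma> * (\<Prod>j\<in>UNIV - {i}. l j ^ a j)"
    then have "l i dvd (\<Prod>j\<in>UNIV - {i}. l j ^ a j)"
      using up prime_elem_dvd_mult_iff[OF prime_l[of i]] by auto
    then obtain j where "j \<noteq> i" "l i dvd l j ^ a j"
      by (rule prime_elem_dvd_prodE[OF prime_l, rotated]) auto
    then show False using l_not_dvd_l[of i j] prime_elem_dvd_power[OF prime_l[of i]] by auto
  qed
  ultimately show False
    using dir_deriv_mult_power_nonzero[OF linear[of i]] i unfolding K by simp
qed

text \<open>
  The scale \<open>q Q\<close> stands for points close to \<open>a / q\<close>. It is enough to know that \<open>a / q\<close> is a maximum
  among its neighbours in coordinate directions there.
\<close>
lemma peak_bound:
  assumes q: "q = CHAR('a) ^ e" "q > 1" and Q: "Q = CHAR('a) ^ s"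
    and a: "\<And>i. a i \<le> q" and i: "\<not> CHAR('a) dvd a i"
    and up: "\<And>j. a j < q \<Longrightarrow> gap (q * Q) (\<lambda>k. Q * a k + of_bool (k = j)) \<le> int Q * gap q a"
    and down: "\<And>j. a j > 0 \<Longrightarrow> gap (q * Q) (\<lambda>k. Q * a k - of_bool (k = j)) \<le> int Q * gap q a"
  shows "gap q a \<le> int CARD('n) - 2"
proof -
  have pq: "CHAR('a) dvd q"
    using q by (cases e) auto
  have interior: "a j > 0" "a j < q" if "\<not> CHAR('a) dvd a j" for j
    using that pq a[of j] by (auto intro!: Nat.gr0I order.not_eq_order_implies_strict)
  obtain \<alpha> \<beta> \<gamma> where S: "syz q a (mdeg q a) (\<alpha>, \<beta>, \<gamma>)" "no_common_factor \<alpha> \<beta> \<gamma>"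
    by (rule minimal_syzygy[OF coprime_forms_scaled])
  then have nz: "(\<alpha>, \<beta>, \<gamma>) \<noteq> (0, 0, 0)" using no_common_factor_nonzero by blast
  have less: "gap q a < int (card {j. \<not> CHAR('a) dvd a j \<and> dir_deriv r s (l j) \<noteq> 0})"
    if "dir_deriv r s (l i) \<noteq> 0" for r s
  proof (rule gap_less_card[OF pq S refl])
    show "i \<in> {j. \<not> CHAR('a) dvd a j \<and> dir_deriv r s (l j) \<noteq> 0}" using that i by simp
    show "\<not> l i dvd \<gamma>"
      by (rule peak_up[OF Q S(1) nz up]) (rule interior(2)[OF i])
    fix j assume "j \<in> {j. \<not> CHAR('a) dvd a j \<and> dir_deriv r s (l j) \<noteq> 0}"
    then have "a j > 0" using interior by blast
    then show "\<not> (l j dvd \<alpha> \<and> l j dvd \<beta>)"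
      by (rule peak_down[OF Q S(1) nz _ down]) (rule \<open>a j > 0\<close>)
  qed
  (* A gap has the parity of the degree sum, and one step changes the degree sum by one. *)
  have "gap q a \<noteq> 0"
  proof
    assume zero: "gap q a = 0"
    then have "gap (q * Q) (\<lambda>k. Q * a k + of_bool (k = i)) = 0"
      using up[OF interior(2)[OF i]] gap_nonneg by (simp add: order_antisym)
    moreover have "total (q * Q) (\<lambda>k. Q * a k + of_bool (k = i)) = Q * total q a + 1"
      by (simp add: total_add total_scale)
    ultimately have odd: "Q * total q a + 1 = 2 * mdeg (q * Q) (\<lambda>k. Q * a k + of_bool (k = i))"
      unfolding gap_eq by linarith
    have even: "total q a = 2 * mdeg q a" using zero unfolding gap_eq by linarith
    have "even (Q * total q a + 1)" unfolding odd by simp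
    moreover have "even (Q * total q a)" unfolding even by simp
    ultimately show False by simp
  qed
  then have pos: "gap q a \<ge> 1" using gap_nonneg[of q a] by linarith
  show ?thesis
  proof (cases "\<exists>j. j \<noteq> i")
    case True
    then obtain j where j: "j \<noteq> i" by blast
    then obtain r s where rs: "dir_deriv r s (l j) = 0" "dir_deriv r s (l i) \<noteq> 0"
      using dir_deriv_separates[OF linear linear l_not_dvd_l] by blast
    have "card {j. \<not> CHAR('a) dvd a j \<and> dir_deriv r s (l j) \<noteq> 0} \<le> card (UNIV - {j})"
      using rs(1) by (intro card_mono) auto
    also have "\<dots> = CARD('n) - 1" by simp
    finally show ?thesis using less[OF rs(2)] pos by linarith
  next
    case False
    obtain r s where rs: "dir_deriv r s (l i) \<noteq> 0"
      using dir_deriv_nonzero_exists[OF linear] by blast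
    have "card {j. \<not> CHAR('a) dvd a j \<and> dir_deriv r s (l j) \<noteq> 0} \<le> card {i}"
      using False by (intro card_mono) auto
    then show ?thesis using less[OF rs] pos by simp
  qed
qed

end

section \<open>From the integer lattice to the cube\<close>

text \<open>Two representations of a point by powers of \<open>p\<close> differ by a power of the Frobenius map.\<close>
lemma (in cell) gap_ratio:
  assumes q: "q = CHAR('a) ^ e" "q' = CHAR('a) ^ e'" and eq: "\<And>i. a i * q' = a' i * q"
  shows "rat_of_int (gap q a) / of_nat q = of_int (gap q' a') / of_nat q'"
proof -
  have pos: "CHAR('a) > 0" using prime_char by (simp add: prime_gt_0_nat)
  have refine: "rat_of_int (gap q a) / of_nat q = of_int (gap q' a') / of_nat q'"
    if "q = CHAR('a) ^ e" "q' = CHAR('a) ^ e'" "\<And>i. a i * q' = a' i * q" "e \<le> e'" for q q' e e' a a'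
  proof -
    define Q where "Q = CHAR('a) ^ (e' - e)"
    have q': "q' = q * Q" unfolding Q_def that(1,2) using that(4) by (simp flip: power_add)
    have "a i * Q = a' i" for i
      using that(3)[of i] pos unfolding q' that(1) by simp
    then have "a' = (\<lambda>i. Q * a i)" by (metis mult.commute)
    then have "gap q' a' = int Q * gap q a"
      using gap_frobenius[OF Q_def] q' by simp
    moreover have "Q > 0" "q > 0" using pos by (simp_all add: Q_def that(1))
    ultimately show ?thesis by (simp add: q' field_simps)
  qed
  show ?thesis
  proof (cases "e \<le> e'")
    case True
    then show ?thesis using refine[OF q eq] by simp
  next
    case False
    then show ?thesis using refine[OF q(2,1) eq[symmetric]] by simp
  qed
qed

lemma (in cell) cell_delta_eq:
  fixes a :: "nat ^ 'n"
  assumes q: "q = CHAR('a) ^ e" and le: "\<And>i. a $ i \<le> q"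
  shows "cell_delta CHAR('a) l (F, G, H) (scaled_point a q) = of_int (gap q (\<lambda>i. a $ i)) / of_nat q"
  unfolding cell_delta_def case_prod_conv
proof (rule the_equality)
  have gap_unfold: "syzygy_gap (F ^ q) (G ^ q) (H ^ q * (\<Prod>i\<in>UNIV. l i ^ (a $ i))) = gap q (\<lambda>i. a $ i)"
    for q and a :: "nat ^ 'n"
    by (simp add: gap_def l_pow_def)
  show "\<forall>q' a'. (\<exists>e. q' = CHAR('a) ^ e) \<longrightarrow> (\<forall>i. a' $ i \<le> q') \<longrightarrow> scaled_point a q = scaled_point a' q' \<longrightarrow>
      of_int (gap q (\<lambda>i. a $ i)) / of_nat q =
      rat_of_int (syzygy_gap (F ^ q') (G ^ q') (H ^ q' * (\<Prod>i\<in>UNIV. l i ^ (a' $ i)))) / of_nat q'"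
  proof (intro allI impI)
    fix q' :: nat and a' :: "nat ^ 'n"
    assume q': "\<exists>e. q' = CHAR('a) ^ e" and pt: "scaled_point a q = scaled_point a' q'"
    obtain e' where e': "q' = CHAR('a) ^ e'" using q' by blast
    have "CHAR('a) > 0" using prime_char by (simp add: prime_gt_0_nat)
    then have pos: "q > 0" "q' > 0" using q e' by simp_all
    have "a $ i * q' = a' $ i * q" for i
    proof -
      have "real (a $ i) / real q = real (a' $ i) / real q'"
        using arg_cong[OF pt, of "\<lambda>v. v $ i"] by (simp add: scaled_point_def)
      then have "real (a $ i * q') = real (a' $ i * q)"
        using pos by (simp add: field_simps)
      then show ?thesis by (simp only: of_nat_eq_iff)
    qed
    then show "of_int (gap q (\<lambda>i. a $ i)) / of_nat q =
        rat_of_int (syzygy_gap (F ^ q') (G ^ q') (H ^ q' * (\<Prod>i\<in>UNIV. l i ^ (a' $ i)))) / of_nat q'"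
      unfolding gap_unfold by (rule gap_ratio[OF q e'])
  qed
  fix v :: rat
  assume "\<forall>q' a'. (\<exists>e. q' = CHAR('a) ^ e) \<longrightarrow> (\<forall>i. a' $ i \<le> q') \<longrightarrow> scaled_point a q = scaled_point a' q' \<longrightarrow>
      v = of_int (syzygy_gap (F ^ q') (G ^ q') (H ^ q' * (\<Prod>i\<in>UNIV. l i ^ (a' $ i)))) / of_nat q'"
  then show "v = of_int (gap q (\<lambda>i. a $ i)) / of_nat q"
    using q le unfolding gap_unfold by blast
qed

lemma scaled_point_in_cube:
  assumes "q = p ^ e" "p > 0" "\<And>i. a $ i \<le> q"
  shows "scaled_point a q \<in> cube_p p"
  unfolding cube_p_def unit_interval_p_def
proof (intro CollectI allI)
  fix i
  have "real (a $ i) \<le> real q" "real q > 0" using assms by simp_all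
  then have "scaled_point a q $ i \<in> {0..1}" by (simp add: scaled_point_def)
  moreover have "scaled_point a q $ i = of_int (int (a $ i)) / of_nat (p ^ e)"
    by (simp add: scaled_point_def assms(1))
  ultimately show "scaled_point a q $ i \<in> {0..1} \<inter> {of_int k / of_nat (p ^ e) |k e. True}"
    by blast
qed

lemma class_delta_eq:
  assumes "\<C> \<in> cell_classes p l"
  obtains F G H where "is_cell l (F, G, H)"
    "\<And>t. t \<in> cube_p p \<Longrightarrow> class_delta p l \<C> t = cell_delta p l (F, G, H) t"
proof -
  obtain C where C: "is_cell l C" "\<C> = cell_equiv p l `` {C}"
    using assms unfolding cell_classes_def by (auto elim!: quotientE)
  have C_in: "C \<in> \<C>" using C by (simp add: cell_equiv_def)
  have "class_delta p l \<C> t = cell_delta p l C t" if "t \<in> cube_p p" for t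
    unfolding class_delta_def
  proof (rule the_equality)
    show "\<forall>C'\<in>\<C>. cell_delta p l C' t = cell_delta p l C t"
      using that C(2) by (auto simp: cell_equiv_def)
  qed (use C_in in metis)
  then show thesis using C(1) that by (metis prod_cases3)
qed

text \<open>
  A neighbourhood of \<open>a / q\<close> contains all lattice neighbours of \<open>a / q\<close> in the cube at every
  sufficiently fine scale, because they are at distance at most \<open>1 / (q p^s)\<close>.
\<close>
lemma local_max_on_scaled_neighbours:
  fixes a :: "nat ^ 'n"
  assumes max: "local_max_on (cube_p p) f (scaled_point a q)" and p: "p > 1" and q: "q = p ^ e"
  shows "\<exists>s. \<forall>a' i. (\<forall>j. a' $ j \<le> q * p ^ s) \<longrightarrow>
      (\<forall>j. \<bar>real (a' $ j) - real (p ^ s * a $ j)\<bar> \<le> of_bool (j = i)) \<longrightarrow>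
      f (scaled_point a' (q * p ^ s)) \<le> f (scaled_point a q)"
proof -
  obtain U where U: "openin (top_of_set (cube_p p)) U" "scaled_point a q \<in> U"
    "\<And>t. t \<in> U \<Longrightarrow> f t \<le> f (scaled_point a q)"
    using max unfolding local_max_on_def by blast
  then obtain V where V: "open V" "U = cube_p p \<inter> V" by (auto simp: openin_open)
  then obtain \<epsilon> where \<epsilon>: "\<epsilon> > 0" "ball (scaled_point a q) \<epsilon> \<subseteq> V"
    using U(2) by (meson IntD2 open_contains_ball)
  obtain s where s: "1 / \<epsilon> < real p ^ s" using real_arch_pow[of "real p" "1 / \<epsilon>"] p by auto
  define N where "N = q * p ^ s"
  have pos: "q > 0" "p ^ s > 0" "N > 0" using p q by (simp_all add: N_def)
  have "1 / real N \<le> 1 / real p ^ s" using pos by (simp add: N_def field_simps)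
  also have "\<dots> < \<epsilon>" using s \<epsilon>(1) p by (simp add: field_simps)
  finally have N: "1 / real N < \<epsilon>" .
  show ?thesis
  proof (intro exI[of _ s] allI impI)
    fix a' :: "nat ^ 'n" and i
    assume le: "\<forall>j. a' $ j \<le> q * p ^ s"
      and near: "\<forall>j. \<bar>real (a' $ j) - real (p ^ s * a $ j)\<bar> \<le> of_bool (j = i)"
    have diff: "(scaled_point a' N - scaled_point a q) $ j = (real (a' $ j) - real (p ^ s * a $ j)) / real N" for j
      using pos by (simp add: scaled_point_def N_def field_simps)
    have "norm (scaled_point a' N - scaled_point a q) \<le> (\<Sum>j\<in>UNIV. \<bar>(scaled_point a' N - scaled_point a q) $ j\<bar>)"
      by (rule norm_le_l1_cart)
    also have "\<dots> = (\<Sum>j\<in>UNIV. \<bar>real (a' $ j) - real (p ^ s * a $ j)\<bar>) / real N"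
      unfolding diff by (simp add: sum_divide_distrib)
    also have "\<dots> \<le> (\<Sum>j\<in>UNIV. of_bool (j = i)) / real N"
      by (intro divide_right_mono sum_mono) (simp_all only: near of_nat_0_le_iff)
    also have "\<dots> = 1 / real N" by simp
    finally have "dist (scaled_point a q) (scaled_point a' N) < \<epsilon>"
      using N by (simp add: dist_norm norm_minus_commute)
    then have "scaled_point a' N \<in> V" using \<epsilon>(2) by auto
    moreover have "scaled_point a' N \<in> cube_p p"
      using p le by (intro scaled_point_in_cube[of _ p "e + s"]) (simp_all add: N_def q power_add)
    ultimately show "f (scaled_point a' (q * p ^ s)) \<le> f (scaled_point a q)"
      using U(3) V(2) unfolding N_def by blast
  qed
qed

theorem theorem3:
  fixes l :: "'n::finite \<Rightarrow> 'a::field poly poly"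
    and p q :: nat
    and a :: "nat ^ 'n"
    and \<C> :: "'a triple set"
  assumes "CHAR('a) = p" and "p > 0"
    and "\<And>i. linear_form (l i)"
    and "\<And>i j. i \<noteq> j \<Longrightarrow> coprime (l i) (l j)"
    and "\<C> \<in> cell_classes p l"
    and "\<exists>e. q = p ^ e" and "q > 1"
    and "\<And>i. a $ i \<le> q"
    and "\<exists>i. \<not> p dvd a $ i"
    and "local_max_on (cube_p p) (class_delta p l \<C>) (scaled_point a q)"
  shows "class_delta p l \<C> (scaled_point a q) \<le> (of_nat CARD('n) - 2) / of_nat q"
proof -
  have prime: "prime CHAR('a)"
    using assms(1,2) prime_CHAR_semidom[where ?'a = 'a] by simp
  then have p: "p > 1" using assms(1) prime_gt_1_nat by blast
  obtain e where e: "q = p ^ e" using assms(6) by blast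
  obtain i where i: "\<not> p dvd a $ i" using assms(9) by blast
  obtain F G H where C: "is_cell l (F, G, H)"
    and on_cube: "\<And>t. t \<in> cube_p p \<Longrightarrow> class_delta p l \<C> t = cell_delta p l (F, G, H) t"
    using class_delta_eq[OF assms(5)] by blast
  interpret cell l F G H
    by unfold_locales (use prime assms(3,4) C in auto)
  have delta: "class_delta p l \<C> (scaled_point b N) = of_int (gap N (\<lambda>i. b $ i)) / of_nat N"
    if "N = p ^ k" "\<And>i. b $ i \<le> N" for N k b
    using on_cube[OF scaled_point_in_cube[OF that(1) assms(2) that(2)]]
      cell_delta_eq[of N k b] that assms(1) by simp
  from local_max_on_scaled_neighbours[OF assms(10) p e]
  obtain s where s: "\<forall>a' i. (\<forall>j. a' $ j \<le> q * p ^ s) \<longrightarrow>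
      (\<forall>j. \<bar>real (a' $ j) - real (p ^ s * a $ j)\<bar> \<le> of_bool (j = i)) \<longrightarrow>
      class_delta p l \<C> (scaled_point a' (q * p ^ s)) \<le> class_delta p l \<C> (scaled_point a q)"
    by (elim exE)
  define Q where "Q = p ^ s"
  have pos: "q > 0" "Q > 0" using p assms(7) by (simp_all add: Q_def)
  have peak: "gap (q * Q) b \<le> int Q * gap q (\<lambda>i. a $ i)"
    if b: "\<And>j. b j \<le> q * Q" "\<And>j. \<bar>real (b j) - real (Q * a $ j)\<bar> \<le> of_bool (j = i)" for b i
  proof -
    have "class_delta p l \<C> (scaled_point (\<chi> j. b j) (q * Q)) \<le> class_delta p l \<C> (scaled_point a q)"
      unfolding Q_def using b
      by (intro s[THEN spec, THEN spec[of _ i], THEN mp, THEN mp]) (simp_all add: Q_def)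
    then have "rat_of_int (gap (q * Q) b) / of_nat (q * Q) \<le> of_int (gap q (\<lambda>i. a $ i)) / of_nat q"
      using delta[of "q * Q" "e + s" "\<chi> j. b j"] delta[OF e assms(8)] b(1)
      by (simp add: e Q_def power_add)
    then have "rat_of_int (gap (q * Q) b) \<le> rat_of_int (int Q * gap q (\<lambda>i. a $ i))"
      using pos by (simp add: field_simps)
    then show ?thesis by (simp only: of_int_le_iff)
  qed
  have "gap q (\<lambda>i. a $ i) \<le> int CARD('n) - 2"
  proof (rule peak_bound[of q e Q s])
    show "\<not> CHAR('a) dvd a $ i" using i assms(1) by simp
    show "gap (q * Q) (\<lambda>k. Q * a $ k + of_bool (k = j)) \<le> int Q * gap q (\<lambda>i. a $ i)" if "a $ j < q" for j
    proof (rule peak[of _ j])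
      fix k
      have "Q * a $ k + of_bool (k = j) \<le> Q * (a $ k + of_bool (k = j))"
        using pos by (simp add: distrib_left)
      also have "\<dots> \<le> Q * q"
        using assms(8)[of k] that by (intro mult_le_mono2) auto
      finally show "Q * a $ k + of_bool (k = j) \<le> q * Q" by (simp only: mult.commute)
    qed simp
    show "gap (q * Q) (\<lambda>k. Q * a $ k - of_bool (k = j)) \<le> int Q * gap q (\<lambda>i. a $ i)" if "a $ j > 0" for j
    proof (rule peak[of _ j])
      fix k
      have "Q * a $ k \<le> q * Q" using assms(8)[of k] by (simp add: mult.commute)
      then show "Q * a $ k - of_bool (k = j) \<le> q * Q" by linarith
      have "k = j \<Longrightarrow> Q * a $ k \<ge> 1" using that pos by (simp add: Suc_le_eq)
      then show "\<bar>real (Q * a $ k - of_bool (k = j)) - real (Q * a $ k)\<bar> \<le> of_bool (k = j)"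
        by (auto simp: of_nat_diff simp del: of_nat_mult)
    qed
  qed (use e assms Q_def in auto)
  then have "rat_of_int (gap q (\<lambda>i. a $ i)) \<le> of_nat CARD('n) - 2"
    by (metis of_int_diff of_int_le_iff of_int_numeral of_int_of_nat_eq)
  then show ?thesis
    unfolding delta[OF e assms(8)] by (simp add: divide_right_mono)
qed

end
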